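(* Let $1<p_1,p_2,q<\infty$. There exist constants $0<k\le K<\infty$ depending only on $p_1,p_2,q$ such that for every compact interval $J=[c,d]$, $c<d$, and all measurable weights $u,v_1,v_2$ on $J$ with $0<u,v_1,v_2<\infty$ a.e. on $J$, $u$ integrable on $J$, and $v_1,v_2$ essentially bounded below on $J$ by positive constants, the optimal constant $C_J$ of the bilinear Hardy inequality on $J$ satisfies $kA\le C_J\le KA$ (in $[0,\infty]$), where - $A=A_1$ if $p_1,p_2\le q$; - $A=A_1+A_2$ if $p_1\le q<p_2$; - $A=A_1+A_3$ if $p_2\le q<p_1$; - $A=A_4+A_5$ if $q<\min\{p_1,p_2\}$ and $\frac1q\le\frac1{p_1}+\frac1{p_2}$; - $A=A_6+A_7$ if $q<\min\{p_1,p_2\}$ and $\frac1q>\frac1{p_1}+\frac1{p_2}$.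
   Context: $C_J$ is the infimum of all finite $C\ge0$ (with $\inf\varnothing=+\infty$) such that $$\left(\int_J\left(\int_c^xf\cdot\int_c^xg\right)^qu(x)\,dx\right)^{1/q}\le C\left(\int_Jf^{p_1}v_1\right)^{1/p_1}\left(\int_Jg^{p_2}v_2\right)^{1/p_2}$$ for all measurable $f,g\ge0$ on $J$ for which both right-hand integrals are finite. Notation: $s'=s/(s-1)$; $U(x)=\int_x^du(t)\,dt$; $V_i(x)=\int_c^xv_i(t)^{1-p_i'}dt$, $i=1,2$. When $q<p_i$, $\frac1{r_i}=\frac1q-\frac1{p_i}$. When $\frac1q>\frac1{p_1}+\frac1{p_2}$, $\frac1\kappa=\frac1q-\frac1{p_1}-\frac1{p_2}$. Define (each in the parameter region in which it is used) - $A_1=\sup_{c<x<d}U(x)^{1/q}V_1(x)^{1/p_1'}V_2(x)^{1/p_2'}$; - $A_2=\sup_{c<x<d}V_1(x)^{1/p_1'}\left[\int_x^dU(t)^{r_2/q}V_2(t)^{r_2/q'}v_2(t)^{1-p_2'}dt\right]^{1/r_2}$; - $A_3=\sup_{c<x<d}V_2(x)^{1/p_2'}\left[\int_x^dU(t)^{r_1/q}V_1(t)^{r_1/q'}v_1(t)^{1-p_1'}dt\right]^{1/r_1}$; - $A_4$ is given by the same formula as $A_2$, and $A_5$ by the same formula as $A_3$ (in the region $q<\min\{p_1,p_2\}$, $\frac1q\le\frac1{p_1}+\frac1{p_2}$); - $A_6=\left[\int_c^d\left(\int_x^dU(t)^{r_2/q}V_2(t)^{r_2/q'}v_2(t)^{1-p_2'}dt\right)^{\kappa/r_2}V_1(x)^{\kappa/r_2'}v_1(x)^{1-p_1'}dx\right]^{1/\kappa}$;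 - $A_7=\left[\int_c^d\left(\int_x^dU(t)^{r_1/q}V_1(t)^{r_1/q'}v_1(t)^{1-p_1'}dt\right)^{\kappa/r_1}V_2(x)^{\kappa/r_1'}v_2(x)^{1-p_2'}dx\right]^{1/\kappa}$. *)

theory Defs
  imports "HOL-Analysis.Analysis"
begin

(* Real powers of [0,\<infinity>]-valued quantities; for negative exponents 0 and \<infinity> are exchanged. *)
definition epowr :: "ennreal \<Rightarrow> real \<Rightarrow> ennreal"  (infixr "epowr" 80) where
  "x epowr a =
     (if a = 0 then 1
      else if x = \<infinity> then (if a > 0 then \<infinity> else 0)
      else if x = 0 \<and> a < 0 then \<infinity>
      else ennreal (enn2real x powr a))"

definition conj_exp :: "real \<Rightarrow> real" where
  "conj_exp s = s / (s - 1)"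

(* 1/r_i = 1/q - 1/p_i; meaningful for q < p_i. *)
definition r_exp :: "real \<Rightarrow> real \<Rightarrow> real" where
  "r_exp q p = 1 / (1 / q - 1 / p)"

(* 1/\<kappa> = 1/q - 1/p1 - 1/p2; meaningful for 1/q > 1/p1 + 1/p2. *)
definition kappa_exp :: "real \<Rightarrow> real \<Rightarrow> real \<Rightarrow> real" where
  "kappa_exp p1 p2 q = 1 / (1 / q - 1 / p1 - 1 / p2)"

definition Utail :: "real \<Rightarrow> (real \<Rightarrow> ennreal) \<Rightarrow> real \<Rightarrow> ennreal" where
  "Utail d u x = (\<integral>\<^sup>+t\<in>{x..d}. u t \<partial>lebesgue)"

definition Vdual :: "real \<Rightarrow> real \<Rightarrow> (real \<Rightarrow> ennreal) \<Rightarrow> real \<Rightarrow> ennreal" where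
  "Vdual c p v x = (\<integral>\<^sup>+t\<in>{c..x}. v t epowr (1 - conj_exp p) \<partial>lebesgue)"

(* The functions f, g may take the value \<infinity>, and C ranges over the finite elements
   of [0,\<infinity>]; in ennreal the infimum of the empty set is \<infinity>. *)
definition bilinear_hardy_const ::
  "real \<Rightarrow> real \<Rightarrow> real \<Rightarrow> real \<Rightarrow> real \<Rightarrow>
   (real \<Rightarrow> ennreal) \<Rightarrow> (real \<Rightarrow> ennreal) \<Rightarrow> (real \<Rightarrow> ennreal) \<Rightarrow> ennreal" where
  "bilinear_hardy_const p1 p2 q c d u v1 v2 =
     Inf {C. C < \<infinity> \<and>
       (\<forall>f \<in> borel_measurable (lebesgue_on {c..d}). \<forall>g \<in> borel_measurable (lebesgue_on {c..d}).
          (\<integral>\<^sup>+x\<in>{c..d}. f x epowr p1 * v1 x \<partial>lebesgue) < \<infinity> \<longrightarrow>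
          (\<integral>\<^sup>+x\<in>{c..d}. g x epowr p2 * v2 x \<partial>lebesgue) < \<infinity> \<longrightarrow>
          (\<integral>\<^sup>+x\<in>{c..d}. ((\<integral>\<^sup>+t\<in>{c..x}. f t \<partial>lebesgue) * (\<integral>\<^sup>+t\<in>{c..x}. g t \<partial>lebesgue)) epowr q
                        * u x \<partial>lebesgue) epowr (1 / q)
          \<le> C * (\<integral>\<^sup>+x\<in>{c..d}. f x epowr p1 * v1 x \<partial>lebesgue) epowr (1 / p1)
              * (\<integral>\<^sup>+x\<in>{c..d}. g x epowr p2 * v2 x \<partial>lebesgue) epowr (1 / p2))}"

definition hardy_A1 ::
  "real \<Rightarrow> real \<Rightarrow> real \<Rightarrow> real \<Rightarrow> real \<Rightarrow>
   (real \<Rightarrow> ennreal) \<Rightarrow> (real \<Rightarrow> ennreal) \<Rightarrow> (real \<Rightarrow> ennreal) \<Rightarrow> ennreal" where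
  "hardy_A1 p1 p2 q c d u v1 v2 =
     (SUP x\<in>{c<..<d}. Utail d u x epowr (1 / q)
                   * Vdual c p1 v1 x epowr (1 / conj_exp p1)
                   * Vdual c p2 v2 x epowr (1 / conj_exp p2))"

definition hardy_A2 ::
  "real \<Rightarrow> real \<Rightarrow> real \<Rightarrow> real \<Rightarrow> real \<Rightarrow>
   (real \<Rightarrow> ennreal) \<Rightarrow> (real \<Rightarrow> ennreal) \<Rightarrow> (real \<Rightarrow> ennreal) \<Rightarrow> ennreal" where
  "hardy_A2 p1 p2 q c d u v1 v2 =
     (let r2 = r_exp q p2 in
      SUP x\<in>{c<..<d}. Vdual c p1 v1 x epowr (1 / conj_exp p1)
        * (\<integral>\<^sup>+t\<in>{x..d}. Utail d u t epowr (r2 / q) * Vdual c p2 v2 t epowr (r2 / conj_exp q)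
                      * v2 t epowr (1 - conj_exp p2) \<partial>lebesgue) epowr (1 / r2))"

definition hardy_A3 ::
  "real \<Rightarrow> real \<Rightarrow> real \<Rightarrow> real \<Rightarrow> real \<Rightarrow>
   (real \<Rightarrow> ennreal) \<Rightarrow> (real \<Rightarrow> ennreal) \<Rightarrow> (real \<Rightarrow> ennreal) \<Rightarrow> ennreal" where
  "hardy_A3 p1 p2 q c d u v1 v2 =
     (let r1 = r_exp q p1 in
      SUP x\<in>{c<..<d}. Vdual c p2 v2 x epowr (1 / conj_exp p2)
        * (\<integral>\<^sup>+t\<in>{x..d}. Utail d u t epowr (r1 / q) * Vdual c p1 v1 t epowr (r1 / conj_exp q)
                      * v1 t epowr (1 - conj_exp p1) \<partial>lebesgue) epowr (1 / r1))"

(* A4 and A5 are the formulas of A2 and A3, used in a different parameter region. *)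
abbreviation (input) "hardy_A4 \<equiv> hardy_A2"
abbreviation (input) "hardy_A5 \<equiv> hardy_A3"

definition hardy_A6 ::
  "real \<Rightarrow> real \<Rightarrow> real \<Rightarrow> real \<Rightarrow> real \<Rightarrow>
   (real \<Rightarrow> ennreal) \<Rightarrow> (real \<Rightarrow> ennreal) \<Rightarrow> (real \<Rightarrow> ennreal) \<Rightarrow> ennreal" where
  "hardy_A6 p1 p2 q c d u v1 v2 =
     (let r2 = r_exp q p2; \<kappa> = kappa_exp p1 p2 q in
      (\<integral>\<^sup>+x\<in>{c..d}.
         (\<integral>\<^sup>+t\<in>{x..d}. Utail d u t epowr (r2 / q) * Vdual c p2 v2 t epowr (r2 / conj_exp q)
                      * v2 t epowr (1 - conj_exp p2) \<partial>lebesgue) epowr (\<kappa> / r2)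
         * Vdual c p1 v1 x epowr (\<kappa> / conj_exp r2)
         * v1 x epowr (1 - conj_exp p1) \<partial>lebesgue) epowr (1 / \<kappa>))"

definition hardy_A7 ::
  "real \<Rightarrow> real \<Rightarrow> real \<Rightarrow> real \<Rightarrow> real \<Rightarrow>
   (real \<Rightarrow> ennreal) \<Rightarrow> (real \<Rightarrow> ennreal) \<Rightarrow> (real \<Rightarrow> ennreal) \<Rightarrow> ennreal" where
  "hardy_A7 p1 p2 q c d u v1 v2 =
     (let r1 = r_exp q p1; \<kappa> = kappa_exp p1 p2 q in
      (\<integral>\<^sup>+x\<in>{c..d}.
         (\<integral>\<^sup>+t\<in>{x..d}. Utail d u t epowr (r1 / q) * Vdual c p1 v1 t epowr (r1 / conj_exp q)
                      * v1 t epowr (1 - conj_exp p1) \<partial>lebesgue) epowr (\<kappa> / r1)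
         * Vdual c p2 v2 x epowr (\<kappa> / conj_exp r1)
         * v2 x epowr (1 - conj_exp p2) \<partial>lebesgue) epowr (1 / \<kappa>))"

definition comparable_with :: "real \<Rightarrow> real \<Rightarrow> ennreal \<Rightarrow> ennreal \<Rightarrow> bool" where
  "comparable_with k K C A \<longleftrightarrow> ennreal k * A \<le> C \<and> C \<le> ennreal K * A"

end

theory Submission
  imports Defs "HOL-Probability.Distribution_Functions"
begin

text \<open>
  Write \<open>\<sigma>\<^sub>i = v\<^sub>i\<close> to the power \<open>1 - p\<^sub>i'\<close> and substitute \<open>f = \<sigma>\<^sub>1 h\<close>, \<open>g = \<sigma>\<^sub>2 k\<close>. Then
  \<open>\<integral>f^p\<^sub>1 v\<^sub>1\<close> becomes the integral of \<open>h^p\<^sub>1\<close> against the finite measure \<open>M\<^sub>1 = \<sigma>\<^sub>1 dx\<close>, the primitive of \<open>f\<close>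
  becomes the running integral \<open>F(x) = \<integral>\<^sub>{t \<le> x} h dM\<^sub>1\<close>, and \<open>V\<^sub>1\<close> becomes the distribution function of
  \<open>M\<^sub>1\<close>; likewise for \<open>g\<close>, and \<open>U\<close> is the tail of \<open>N = u dx\<close>. The theorem is therefore a statement about
  three finite measures on the line without atoms, and most of the text is about such measures.
  Calculus is available for them, because a distribution function carries its own measure to
  Lebesgue measure (\<open>distr_distribution_fun\<close>); this gives the chain rule \<open>d(F^a) = a F^(a-1) dF\<close>
  for every \<open>a > 0\<close> (\<open>cumul_powr\<close>, \<open>tail_powr\<close>), negative powers of \<open>F\<close> included.

  Upper bound. By the product rule for \<open>F^q G^q\<close> and Fubini, \<open>\<integral>(FG)^q dN\<close> is at most \<open>q\<close> times the sum of
  \<open>\<integral>U G^q F^(q-1) h dM\<^sub>1\<close> and of the term with the two functions exchanged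
  (\<open>integral_product_powr_le\<close>). Each term has the form \<open>\<integral>w F^(q-1) h dM\<^sub>1\<close>. The Hardy inequality
  controls the averages \<open>F / V\<^sub>1\<close> in \<open>L^p\<^sub>1\<close>, and the Hoelder inequality then bounds this integral by
  \<open>\<parallel>h\<parallel>^q\<close> times the supremum of \<open>w V\<^sub>1^(q/p\<^sub>1')\<close> if \<open>p\<^sub>1 \<le> q\<close>, and times an integral norm of \<open>w\<close> if
  \<open>q < p\<^sub>1\<close> (\<open>Hardy_term_bound_le\<close>, \<open>Hardy_term_bound_gt\<close>). In the first case the pointwise bound of
  \<open>G\<close> by its norm produces \<open>A\<^sub>1\<close>. In the second case there remains a linear inequality for \<open>G\<close> in
  \<open>L^r\<^sub>1\<close> of a new weight; the same two estimates, now with exponents \<open>r\<^sub>1\<close> and \<open>p\<^sub>2\<close>, give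
  \<open>A\<^sub>3 = A\<^sub>5\<close> if \<open>p\<^sub>2 \<le> r\<^sub>1\<close> and \<open>A\<^sub>7\<close> if \<open>r\<^sub>1 < p\<^sub>2\<close>. The other term gives \<open>A\<^sub>1\<close>, \<open>A\<^sub>2 = A\<^sub>4\<close>, \<open>A\<^sub>6\<close>.

  Lower bound. Indicators of \<open>[c,x]\<close> give \<open>A\<^sub>1\<close>. For \<open>A\<^sub>2\<close> and \<open>A\<^sub>6\<close>, fix \<open>f\<close>: the inequality is then a
  linear Hardy inequality in \<open>g\<close> for the measure \<open>F^q dN\<close>, and since \<open>q < p\<^sub>2\<close> an explicit test function
  bounds its constant from below (\<open>Hardy_test_function\<close>). The tail of \<open>F^q dN\<close> at \<open>t\<close> is at least
  \<open>F(t)^q U(t)\<close>, so what remains is a linear Hardy inequality for \<open>f\<close> in \<open>L^r\<^sub>2\<close> of the new weight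
  (\<open>bilinear_Hardy_partial_necessity\<close>). Testing it on an indicator gives \<open>A\<^sub>2\<close>, and on the explicit
  function, when \<open>r\<^sub>2 < p\<^sub>1\<close>, gives \<open>A\<^sub>6\<close>.
\<close>

section \<open>Powers of extended nonnegative reals and the Hoelder inequality\<close>

lemma epowr_0 [simp]: "x epowr 0 = 1"
  by (simp add: epowr_def)

lemma zero_epowr [simp]: "a > 0 \<Longrightarrow> 0 epowr a = 0"
  by (simp add: epowr_def)

lemma top_epowr [simp]: "a > 0 \<Longrightarrow> top epowr a = top"
  by (simp add: epowr_def)

lemma epowr_ennreal: "0 < x \<Longrightarrow> ennreal x epowr a = ennreal (x powr a)"
  by (simp add: epowr_def)

lemma one_epowr [simp]: "1 epowr a = 1"
  using epowr_ennreal[of 1 a] by simp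

lemma epowr_1 [simp]: "x epowr 1 = x"
  by (auto simp: epowr_def less_top)

lemma ennreal_zero_top_pos_cases:
  obtains "x = 0" | "x = top" | r where "0 < r" "x = ennreal r"
  by (cases x; cases "x = 0") (auto simp: ennreal_eq_0_iff not_le)

lemma epowr_measurable [measurable (raw)]:
  assumes [measurable]: "f \<in> borel_measurable M"
  shows "(\<lambda>x. f x epowr a) \<in> borel_measurable M"
  unfolding epowr_def by measurable

lemma epowr_epowr [simp]: "(x epowr a) epowr b = x epowr (a * b)"
  by (cases x rule: ennreal_zero_top_pos_cases)
     (auto simp: epowr_def powr_powr zero_less_mult_iff mult_less_0_iff)

text \<open>
  The sign condition excludes \<open>0 * \<infinity>\<close>: a negative power exchanges the two factors and leaves
  \<open>\<infinity> * 0 = 0\<close> where the left-hand side is \<open>\<infinity>\<close>.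
\<close>

lemma epowr_mult: "0 \<le> a \<Longrightarrow> (x * y) epowr a = x epowr a * y epowr a"
  by (cases "a = 0"; cases x rule: ennreal_zero_top_pos_cases; cases y rule: ennreal_zero_top_pos_cases)
     (auto simp: epowr_ennreal powr_mult ennreal_mult_top ennreal_top_mult ennreal_mult[symmetric])

lemma epowr_add: "0 \<le> a \<Longrightarrow> 0 \<le> b \<Longrightarrow> x epowr (a + b) = x epowr a * x epowr b"
  by (cases "a = 0"; cases "b = 0"; cases x rule: ennreal_zero_top_pos_cases)
     (auto simp: epowr_ennreal powr_add ennreal_mult[symmetric])

lemma epowr_add_pos_fin: "0 < x \<Longrightarrow> x < top \<Longrightarrow> x epowr (a + b) = x epowr a * x epowr b"
  by (cases x rule: ennreal_zero_top_pos_cases)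
     (auto simp: epowr_ennreal powr_add ennreal_mult[symmetric])

lemma epowr_mono: "0 \<le> a \<Longrightarrow> x \<le> y \<Longrightarrow> x epowr a \<le> y epowr a"
  by (cases "a = 0"; cases x rule: ennreal_zero_top_pos_cases; cases y rule: ennreal_zero_top_pos_cases)
     (auto simp: epowr_ennreal powr_mono2 top_unique)

lemma epowr_less_top [simp]: "0 \<le> a \<Longrightarrow> x < top \<Longrightarrow> x epowr a < top"
  by (cases "a = 0"; cases x rule: ennreal_zero_top_pos_cases)
     (auto simp: epowr_ennreal)

lemma epowr_eq_0_iff [simp]: "0 < a \<Longrightarrow> x epowr a = 0 \<longleftrightarrow> x = 0"
  by (cases x rule: ennreal_zero_top_pos_cases) (auto simp: epowr_ennreal)

lemma epowr_pos_fin: "0 < x \<Longrightarrow> x < top \<Longrightarrow> 0 < x epowr a \<and> x epowr a < top"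
  by (cases x rule: ennreal_zero_top_pos_cases) (auto simp: epowr_ennreal)

lemma epowr_cancel: "0 < x \<Longrightarrow> x < top \<Longrightarrow> x epowr a * x epowr (- a) = 1"
  using epowr_add_pos_fin[of x a "-a"] by simp

lemma Young_epowr:
  assumes "0 < a" "0 < b" "a + b = 1"
  shows "x epowr a * y epowr b \<le> ennreal a * x + ennreal b * y"
  using assms
  by (cases x rule: ennreal_zero_top_pos_cases; cases y rule: ennreal_zero_top_pos_cases)
     (auto simp: epowr_ennreal Youngs_inequality_0 ennreal_mult_top simp flip: ennreal_mult ennreal_plus)

text \<open>
  The exponents sit on the integrands, so \<open>a\<close> and \<open>b\<close> are the reciprocals of the usual conjugate
  exponents. After division by the two integrals the inequality is the integrated Young inequality;
  an integral equal to \<open>0\<close> or \<open>\<infinity>\<close> is treated apart.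
\<close>

lemma Holder_nn_integral:
  assumes [measurable]: "f \<in> borel_measurable M" "g \<in> borel_measurable M"
    and ab: "0 < a" "0 < b" "a + b = 1"
  shows "(\<integral>\<^sup>+x. f x epowr a * g x epowr b \<partial>M)
           \<le> (\<integral>\<^sup>+x. f x \<partial>M) epowr a * (\<integral>\<^sup>+x. g x \<partial>M) epowr b"
proof -
  define A where "A = (\<integral>\<^sup>+x. f x \<partial>M)"
  define B where "B = (\<integral>\<^sup>+x. g x \<partial>M)"
  consider "A = 0 \<or> B = 0" | "A \<noteq> 0" "B \<noteq> 0" "A = top \<or> B = top" | "0 < A" "A < top" "0 < B" "B < top"
    by (meson less_top zero_less_iff_neq_zero)
  then show ?thesis
  proof cases
    case 1
    then have "AE x in M. f x epowr a * g x epowr b = 0"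
      using ab by (auto simp: A_def B_def nn_integral_0_iff_AE)
    then have "(\<integral>\<^sup>+x. f x epowr a * g x epowr b \<partial>M) = 0"
      by (subst nn_integral_0_iff_AE) auto
    then show ?thesis by simp
  next
    case 2
    then have "A epowr a * B epowr b = top"
      using ab by (auto simp: ennreal_mult_eq_top_iff)
    then show ?thesis by (simp add: A_def B_def)
  next
    case 3
    have inv: "C epowr -1 * C = 1" if "0 < C" "C < top" for C
      using epowr_add_pos_fin[OF that, of "-1" 1] by simp
    have scale: "C epowr c * (h * C epowr -1) epowr c = h epowr c" if "0 < C" "C < top" "0 < c" for C c h
      using that epowr_add_pos_fin[of C c "-c"]
      by (simp add: epowr_mult) (metis mult.left_commute mult.right_neutral)
    have "(\<integral>\<^sup>+x. f x epowr a * g x epowr b \<partial>M)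
        = (\<integral>\<^sup>+x. (A epowr a * B epowr b) * ((f x * A epowr -1) epowr a * (g x * B epowr -1) epowr b) \<partial>M)"
      using scale[of A a] scale[of B b] 3 ab
      by (intro nn_integral_cong) (metis (no_types, lifting) mult.assoc mult.left_commute)
    also have "\<dots> \<le> (\<integral>\<^sup>+x. (A epowr a * B epowr b) *
                 (ennreal a * (f x * A epowr -1) + ennreal b * (g x * B epowr -1)) \<partial>M)"
      using ab by (intro nn_integral_mono mult_left_mono Young_epowr) auto
    also have "\<dots> = (A epowr a * B epowr b) * (ennreal a * (A * A epowr -1) + ennreal b * (B * B epowr -1))"
      by (simp add: nn_integral_cmult nn_integral_add nn_integral_multc A_def B_def)
    also have "\<dots> = A epowr a * B epowr b"
      using inv[of A] inv[of B] 3 ab by (simp add: mult.commute flip: ennreal_plus)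
    finally show ?thesis by (simp add: A_def B_def)
  qed
qed

text \<open>
  The last two factors are grouped with weights \<open>b/(b+c)\<close> and \<open>c/(b+c)\<close>, and the inequality for two
  factors is applied twice.
\<close>

lemma Holder_nn_integral3:
  assumes [measurable]: "f \<in> borel_measurable M" "g \<in> borel_measurable M" "h \<in> borel_measurable M"
    and ab: "0 < a" "0 < b" "0 < c" "a + b + c = 1"
  shows "(\<integral>\<^sup>+x. f x epowr a * g x epowr b * h x epowr c \<partial>M)
           \<le> (\<integral>\<^sup>+x. f x \<partial>M) epowr a * (\<integral>\<^sup>+x. g x \<partial>M) epowr b * (\<integral>\<^sup>+x. h x \<partial>M) epowr c"
proof -
  have "b + c > 0" using ab by simp
  have "(\<integral>\<^sup>+x. f x epowr a * g x epowr b * h x epowr c \<partial>M)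
      = (\<integral>\<^sup>+x. f x epowr a * (g x epowr (b/(b+c)) * h x epowr (c/(b+c))) epowr (b+c) \<partial>M)"
    using ab \<open>b + c > 0\<close> by (simp add: epowr_mult mult.assoc)
  also have "\<dots> \<le> (\<integral>\<^sup>+x. f x \<partial>M) epowr a * (\<integral>\<^sup>+x. g x epowr (b/(b+c)) * h x epowr (c/(b+c)) \<partial>M) epowr (b+c)"
    using ab by (intro Holder_nn_integral) auto
  also have "\<dots> \<le> (\<integral>\<^sup>+x. f x \<partial>M) epowr a
      * ((\<integral>\<^sup>+x. g x \<partial>M) epowr (b/(b+c)) * (\<integral>\<^sup>+x. h x \<partial>M) epowr (c/(b+c))) epowr (b+c)"
    using ab \<open>b + c > 0\<close> 
    by (intro mult_left_mono epowr_mono Holder_nn_integral) (auto simp flip: add_divide_distrib)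
  also have "\<dots> = (\<integral>\<^sup>+x. f x \<partial>M) epowr a * (\<integral>\<^sup>+x. g x \<partial>M) epowr b * (\<integral>\<^sup>+x. h x \<partial>M) epowr c"
    using ab \<open>b + c > 0\<close> by (simp add: epowr_mult mult.assoc)
  finally show ?thesis .
qed

section \<open>Diffuse measures on the line and the distribution of their distribution function\<close>

text \<open>
  The \<open>\<sigma>\<close>-algebra is only required to make the identity measurable, so that Lebesgue measurable
  functions are admitted along with Borel ones.
\<close>

locale diffuse_measure = finite_measure M for M :: "real measure" +
  assumes ident_measurable [measurable]: "(\<lambda>x. x) \<in> borel_measurable M"
    and null_points: "AE x in M. x \<noteq> a"

definition cumul :: "real measure \<Rightarrow> (real \<Rightarrow> ennreal) \<Rightarrow> real \<Rightarrow> ennreal" where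
  "cumul M f x = (\<integral>\<^sup>+t. f t * indicator {..x} t \<partial>M)"

definition tail :: "real measure \<Rightarrow> (real \<Rightarrow> ennreal) \<Rightarrow> real \<Rightarrow> ennreal" where
  "tail M f x = (\<integral>\<^sup>+t. f t * indicator {x..} t \<partial>M)"

abbreviation distribution_fun :: "real measure \<Rightarrow> real \<Rightarrow> ennreal" where
  "distribution_fun M \<equiv> cumul M (\<lambda>_. 1)"

lemma diffuse_measure_density:
  assumes "diffuse_measure M" and [measurable]: "f \<in> borel_measurable M"
    and fin: "(\<integral>\<^sup>+x. f x \<partial>M) < \<infinity>"
  shows "diffuse_measure (density M f)"
proof -
  interpret diffuse_measure M by fact
  show ?thesis
  proof (intro diffuse_measure.intro finite_measureI diffuse_measure_axioms.intro)
    show "emeasure (density M f) (space (density M f)) \<noteq> \<infinity>"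
      using fin by (simp add: emeasure_density cong: nn_integral_cong)
  next
    fix a show "AE x in density M f. x \<noteq> a"
      using null_points[of a] by (auto simp: AE_density elim: eventually_mono)
  qed simp
qed

context diffuse_measure
begin

lemma cumul_measurable [measurable (raw)]:
  assumes [measurable]: "f \<in> borel_measurable M" "g \<in> borel_measurable N"
  shows "(\<lambda>x. cumul M f (g x)) \<in> borel_measurable N"
proof -
  have [measurable]: "Measurable.pred (N \<Otimes>\<^sub>M M) (\<lambda>x. snd x \<le> g (fst x))"
    by measurable
  have *: "f t * indicator {..g x} t = (if t \<le> g x then f t else 0)" for x t
    by (simp add: indicator_def)
  show ?thesis unfolding cumul_def * by measurable
qed

lemma tail_measurable [measurable (raw)]:
  assumes [measurable]: "f \<in> borel_measurable M" "g \<in> borel_measurable N"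
  shows "(\<lambda>x. tail M f (g x)) \<in> borel_measurable N"
proof -
  have [measurable]: "Measurable.pred (N \<Otimes>\<^sub>M M) (\<lambda>x. snd x \<ge> g (fst x))"
    by measurable
  have *: "f t * indicator {g x..} t = (if t \<ge> g x then f t else 0)" for x t
    by (simp add: indicator_def)
  show ?thesis unfolding tail_def * by measurable
qed

lemma borel_distr: "finite_borel_measure (distr M borel (\<lambda>x. x))"
proof -
  interpret D: finite_measure "distr M borel (\<lambda>x. x)"
    by (rule finite_measure_distr) simp
  show ?thesis by unfold_locales simp
qed

lemma distribution_fun_eq_cdf: "distribution_fun M x = ennreal (cdf (distr M borel (\<lambda>x. x)) x)"
proof -
  have "distribution_fun M x = (\<integral>\<^sup>+t. indicator {..x} t \<partial>distr M borel (\<lambda>x. x))"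
    unfolding cumul_def by (subst nn_integral_distr) auto
  also have "\<dots> = emeasure (distr M borel (\<lambda>x. x)) {..x}"
    by (simp add: nn_integral_indicator)
  also have "\<dots> = ennreal (cdf (distr M borel (\<lambda>x. x)) x)"
    using finite_borel_measure.axioms(1)[OF borel_distr] 
    by (simp add: cdf_def finite_measure.emeasure_eq_measure)
  finally show ?thesis .
qed

text \<open>
  The distribution function of a measure without atoms is uniformly distributed: it carries \<open>M\<close> to
  Lebesgue measure on \<open>[0, M(\<real>)]\<close>. All the calculus below rests on this change of variables.
  It holds because the distribution function is continuous and monotone, so that the set where it
  is at most \<open>s\<close> is a half-line \<open>(-\<infinity>, z]\<close> whose measure is exactly \<open>s\<close>.
\<close>

lemma distr_distribution_fun:
  assumes [measurable]: "g \<in> borel_measurable borel"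
  shows "(\<integral>\<^sup>+t. g (distribution_fun M t) \<partial>M)
       = (\<integral>\<^sup>+s. g (ennreal s) * indicator {0..measure M (space M)} s \<partial>lborel)"
proof -
  define D where "D = distr M borel (\<lambda>x. x)"
  define m where "m = measure M (space M)"
  interpret D: finite_borel_measure D
    unfolding D_def by (rule borel_distr)
  have [measurable_cong, simp]: "sets D = sets borel" by (rule D.M_is_borel)
  have m: "m = measure D (space D)" "0 \<le> m"
    by (simp_all add: m_def D_def measure_distr)
  have iso: "isCont (cdf D) x" for x
  proof -
    have "{y \<in> space M. y = x} \<in> sets M"
      by measurable
    then have "emeasure M {y \<in> space M. y = x} = 0"
      using null_points[of x] AE_iff_measurable[of "{y \<in> space M. y = x}" M "\<lambda>y. y \<noteq> x"] by simp
    moreover have "(\<lambda>x. x) -` {x} \<inter> space M = {y \<in> space M. y = x}" by auto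
    ultimately have "emeasure M ((\<lambda>x. x) -` {x} \<inter> space M) = 0" by simp
    then have "measure D {x} = 0"
      by (simp add: D_def measure_def emeasure_distr)
    then show ?thesis by (simp add: D.isCont_cdf)
  qed
  have [measurable]: "cdf D \<in> borel_measurable borel"
    by (intro borel_measurable_mono monoI D.cdf_nondecreasing)
  then have [measurable]: "cdf D \<in> borel_measurable D"
    by (subst measurable_cong_sets[of D borel borel borel]) auto
  have level: "emeasure D {t. s < cdf D t} = ennreal (m - s)" if s: "0 \<le> s" "s < m" for s
  proof -
    have "\<exists>y. cdf D y > s"
      using order_tendstoD(1)[OF D.cdf_lim_at_top, of s] s m
      by (auto simp: eventually_at_top_linorder)
    then obtain y where y: "cdf D y > s" ..
    define S where "S = {t. cdf D t \<le> s}"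
    have bdd: "t \<le> y" if "t \<in> S" for t
      using that y D.cdf_nondecreasing[of y t] by (force simp: S_def)
    have *: "emeasure D (-S) = m - measure D S" if "S \<in> sets borel"
      using that m D.finite_measure_compl[of S] D.borel_UNIV
      by (simp add: D.emeasure_eq_measure Compl_eq_Diff_UNIV D.sets_M)
    \<comment> \<open>The set \<open>S\<close> may be empty, but then \<open>s = 0\<close>, since the distribution function tends to \<open>0\<close> at \<open>-\<infinity>\<close>.\<close>
    have "measure D S = s"
    proof (cases "S = {}")
      case True
      have "s \<le> 0"
      proof (rule tendsto_lowerbound[OF D.cdf_lim_at_bot])
        show "\<forall>\<^sub>F x in at_bot. s \<le> cdf D x" using True by (auto simp: S_def not_le intro!: always_eventually less_imp_le)
      qed simp
      with True s show ?thesis by simp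
    next
      case False
      have bdd': "bdd_above S" by (rule bdd_aboveI[of _ y]) (rule bdd)
      have cl: "closed S"
        unfolding S_def by (intro closed_Collect_le continuous_on_const continuous_at_imp_continuous_on) (auto simp: iso)
      define z where "z = Sup S"
      have "z \<in> S"
        unfolding z_def using False bdd' cl by (rule closed_contains_Sup)
      have S: "S = {..z}"
        using \<open>z \<in> S\<close> bdd' D.cdf_nondecreasing
        by (auto simp: z_def intro: cSup_upper) (auto simp: S_def intro: order_trans)
      have "cdf D z \<ge> s"
      proof (rule tendsto_lowerbound)
        show "(cdf D \<longlongrightarrow> cdf D z) (at_right z)"
          using iso[of z] by (simp add: isCont_def filterlim_at_split)
        show "\<forall>\<^sub>F x in at_right z. s \<le> cdf D x"
          using S by (auto simp: eventually_at_filter S_def set_eq_iff not_le intro!: always_eventually less_imp_le)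
             (metis linorder_not_less order_less_imp_le)
      qed simp
      then have "cdf D z = s" using \<open>z \<in> S\<close> by (auto simp: S_def)
      then show ?thesis by (simp add: S cdf_def)
    qed
    moreover have "S \<in> sets borel" unfolding S_def by measurable
    moreover have "{t. s < cdf D t} = -S" by (auto simp: S_def)
    ultimately show ?thesis using * by simp
  qed
  have eq: "distr D borel (cdf D) = density lborel (indicator {0..m})"
  proof (rule measure_eqI_lessThan)
    fix s :: real
    have R: "emeasure (density lborel (indicator {0..m})) {s<..} = emeasure lborel ({0..m} \<inter> {s<..})"
      by (simp add: emeasure_density nn_integral_indicator flip: indicator_inter_arith)
    have L: "emeasure (distr D borel (cdf D)) {s<..} = emeasure D {t. s < cdf D t}"
      by (subst emeasure_distr) (auto simp: D.borel_UNIV vimage_def)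
    show "emeasure (distr D borel (cdf D)) {s<..} < \<infinity>"
      unfolding L by (simp add: D.emeasure_eq_measure)
    consider "s < 0" | "0 \<le> s" "s < m" | "m \<le> s" by linarith
    then show "emeasure (distr D borel (cdf D)) {s<..} = emeasure (density lborel (indicator {0..m})) {s<..}"
    proof cases
      case 1
      have "{t. s < cdf D t} = space D" "{0..m} \<inter> {s<..} = {0..m}"
        using 1 D.cdf_nonneg by (auto simp: D.borel_UNIV less_le_trans)
      then show ?thesis unfolding L R using m by (simp add: D.emeasure_eq_measure)
    next
      case 2
      have "{0..m} \<inter> {s<..} = {s<..m}" using 2 by auto
      then show ?thesis unfolding L R using level[OF 2] 2 by simp
    next
      case 3
      have "{t. s < cdf D t} = {}" "{0..m} \<inter> {s<..} = {}"
        using 3 D.cdf_bounded m by (auto simp: not_less intro: order_trans)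
      then show ?thesis unfolding L R by simp
    qed
  qed (auto)
  have "(\<integral>\<^sup>+t. g (distribution_fun M t) \<partial>M) = (\<integral>\<^sup>+t. g (ennreal (cdf D t)) \<partial>D)"
    unfolding distribution_fun_eq_cdf D_def[symmetric]
    unfolding D_def by (subst nn_integral_distr) (auto simp flip: D_def)
  also have "\<dots> = (\<integral>\<^sup>+s. g (ennreal s) \<partial>distr D borel (cdf D))"
    by (subst nn_integral_distr) auto
  also have "\<dots> = (\<integral>\<^sup>+s. g (ennreal s) * indicator {0..m} s \<partial>lborel)"
    unfolding eq by (subst nn_integral_density) (auto simp: mult.commute)
  finally show ?thesis unfolding m_def .
qed

end

section \<open>The chain rule and the exchange of order of integration\<close>

lemma cumul_density:
  assumes [measurable]: "(\<lambda>x. x) \<in> borel_measurable M" "w \<in> borel_measurable M" "f \<in> borel_measurable M"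
  shows "cumul (density M w) f x = cumul M (\<lambda>t. w t * f t) x"
  unfolding cumul_def by (subst nn_integral_density) (auto simp: mult.assoc)

lemma tail_density:
  assumes [measurable]: "(\<lambda>x. x) \<in> borel_measurable M" "w \<in> borel_measurable M" "f \<in> borel_measurable M"
  shows "tail (density M w) f x = tail M (\<lambda>t. w t * f t) x"
  unfolding tail_def by (subst nn_integral_density) (auto simp: mult.assoc)

lemma cumul_cmult:
  assumes [measurable]: "(\<lambda>x. x) \<in> borel_measurable M" "f \<in> borel_measurable M"
  shows "cumul M (\<lambda>t. c * f t) x = c * cumul M f x"
  unfolding cumul_def by (simp add: mult.assoc nn_integral_cmult)

lemma cumul_le_integral: "cumul M f x \<le> (\<integral>\<^sup>+t. f t \<partial>M)"
  unfolding cumul_def by (intro nn_integral_mono) (auto simp: indicator_def)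

lemma tail_le_integral: "tail M f x \<le> (\<integral>\<^sup>+t. f t \<partial>M)"
  unfolding tail_def by (intro nn_integral_mono) (auto simp: indicator_def)

lemma cumul_mono: "x \<le> y \<Longrightarrow> cumul M f x \<le> cumul M f y"
  unfolding cumul_def by (intro nn_integral_mono) (auto simp: indicator_def)

lemma tail_antimono: "x \<le> y \<Longrightarrow> tail M f y \<le> tail M f x"
  unfolding tail_def by (intro nn_integral_mono) (auto simp: indicator_def)

lemma cumul_cong_AE:
  assumes "AE t in M. f t = g t"
  shows "cumul M f x = cumul M g x"
  unfolding cumul_def using assms by (intro nn_integral_cong_AE) (auto elim: eventually_mono)

lemma cumul_Holder:
  assumes [measurable]: "(\<lambda>x. x) \<in> borel_measurable M" "f \<in> borel_measurable M" "g \<in> borel_measurable M"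
    and ab: "0 < a" "0 < b" "a + b = 1"
  shows "cumul M (\<lambda>t. f t epowr a * g t epowr b) x \<le> cumul M f x epowr a * cumul M g x epowr b"
proof -
  have "cumul M (\<lambda>t. f t epowr a * g t epowr b) x
      = (\<integral>\<^sup>+t. (f t * indicator {..x} t) epowr a * (g t * indicator {..x} t) epowr b \<partial>M)"
    unfolding cumul_def using ab by (intro nn_integral_cong) (auto simp: indicator_def)
  also have "\<dots> \<le> cumul M f x epowr a * cumul M g x epowr b"
    unfolding cumul_def by (intro Holder_nn_integral ab) measurable
  finally show ?thesis .
qed

context diffuse_measure
begin

lemma integral_distribution_fun_powr:
  assumes a: "0 < a"
  shows "ennreal a * (\<integral>\<^sup>+t. distribution_fun M t epowr (a - 1) \<partial>M) = emeasure M (space M) epowr a"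
proof -
  define m where "m = measure M (space M)"
  have m: "0 \<le> m" "emeasure M (space M) = ennreal m"
    by (simp_all add: m_def emeasure_eq_measure)
  have "(\<integral>\<^sup>+t. distribution_fun M t epowr (a - 1) \<partial>M)
      = (\<integral>\<^sup>+s. ennreal s epowr (a - 1) * indicator {0..m} s \<partial>lborel)"
    unfolding m_def by (rule distr_distribution_fun) measurable
  also have "\<dots> = (\<integral>\<^sup>+s. ennreal (if s \<in> {0..m} then s powr (a - 1) else 0) \<partial>lborel)"
  proof (rule nn_integral_cong_AE)
    show "AE s in lborel. ennreal s epowr (a - 1) * indicator {0..m} s
            = ennreal (if s \<in> {0..m} then s powr (a - 1) else 0)"
      using AE_lborel_singleton[of 0] 
      by eventually_elim (auto simp: epowr_ennreal indicator_def)
  qed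
  also have "\<dots> = ennreal (m powr (a - 1 + 1) / (a - 1 + 1))"
  proof (rule nn_integral_has_integral_lborel)
    show "((\<lambda>s. if s \<in> {0..m} then s powr (a - 1) else 0) has_integral m powr (a - 1 + 1) / (a - 1 + 1)) UNIV"
      unfolding has_integral_restrict_UNIV using a m by (intro has_integral_powr_from_0) auto
  qed auto
  finally show ?thesis
    using a m by (cases "m = 0") (auto simp: epowr_ennreal simp flip: ennreal_mult)
qed

lemma density_diffuse:
  assumes "f \<in> borel_measurable M" "(\<integral>\<^sup>+x. f x \<partial>M) < \<infinity>"
  shows "diffuse_measure (density M f)"
  using assms diffuse_measure_density[OF diffuse_measure_axioms] by blast

text \<open>
  The chain rule. The measure with density \<open>f\<close> restricted to \<open>(-\<infinity>, x]\<close> has total mass \<open>F(x)\<close> and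
  distribution function \<open>F\<close> up to \<open>x\<close>, where \<open>F\<close> is the running integral of \<open>f\<close>, so the identity is
  the integral of \<open>s^(a-1)\<close> over \<open>[0, F(x)]\<close>. For \<open>a < 1\<close> the integrand is singular where \<open>F\<close>
  vanishes, which does no harm: that set is null for this measure.
\<close>

lemma cumul_powr:
  assumes [measurable]: "f \<in> borel_measurable M" and fin: "(\<integral>\<^sup>+x. f x \<partial>M) < \<infinity>" and a: "0 < a"
  shows "cumul M f x epowr a = ennreal a * cumul M (\<lambda>t. cumul M f t epowr (a - 1) * f t) x"
proof -
  define h where "h = (\<lambda>t. f t * indicator {..x} t)"
  have [measurable]: "h \<in> borel_measurable M" unfolding h_def by measurable
  define N where "N = density M h"
  have "(\<integral>\<^sup>+x. h x \<partial>M) < \<infinity>"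
    using le_less_trans[OF cumul_le_integral[of M f x] fin] by (simp add: h_def cumul_def)
  then interpret N: diffuse_measure N
    unfolding N_def by (intro density_diffuse) auto
  have total: "emeasure N (space N) = cumul M f x"
    by (simp add: N_def emeasure_density h_def cumul_def cong: nn_integral_cong)
  have V: "distribution_fun N t = cumul M f t" if "t \<le> x" for t
    unfolding N_def using that
    by (subst cumul_density) (auto simp: h_def cumul_def indicator_def intro!: nn_integral_cong)
  have "(\<integral>\<^sup>+t. distribution_fun N t epowr (a - 1) \<partial>N) = (\<integral>\<^sup>+t. h t * distribution_fun N t epowr (a - 1) \<partial>M)"
  proof -
    have "(\<lambda>t. distribution_fun N t) \<in> borel_measurable M"
      by measurable
    then show ?thesis unfolding N_def by (subst nn_integral_density) auto
  qed
  also have "\<dots> = cumul M (\<lambda>t. cumul M f t epowr (a - 1) * f t) x"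
    unfolding cumul_def[of M "\<lambda>t. cumul M f t epowr (a - 1) * f t"]
    by (intro nn_integral_cong) (auto simp: h_def V indicator_def mult.commute)
  finally show ?thesis
    using N.integral_distribution_fun_powr[OF a] by (simp add: total)
qed

text \<open>
  Reflection at the origin turns tails into distribution functions.
\<close>

lemma integral_tail_powr:
  assumes a: "0 < a"
  shows "ennreal a * (\<integral>\<^sup>+t. tail M (\<lambda>_. 1) t epowr (a - 1) \<partial>M) = emeasure M (space M) epowr a"
proof -
  define N where "N = distr M borel uminus"
  interpret N: diffuse_measure N
  proof (intro diffuse_measure.intro diffuse_measure_axioms.intro)
    show "finite_measure N" unfolding N_def by (rule finite_measure_distr) simp
    fix b show "AE x in N. x \<noteq> b"
      using null_points[of "-b"] unfolding N_def 
      by (subst AE_distr_iff) (auto elim: eventually_mono)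
  qed (simp add: N_def)
  have "distribution_fun N t = tail M (\<lambda>_. 1) (- t)" for t
    unfolding N_def cumul_def tail_def
    by (subst nn_integral_distr) (auto simp: indicator_def intro!: nn_integral_cong)
  then have "(\<integral>\<^sup>+t. distribution_fun N t epowr (a - 1) \<partial>N) = (\<integral>\<^sup>+t. tail M (\<lambda>_. 1) (-t) epowr (a - 1) \<partial>N)"
    by simp
  also have "\<dots> = (\<integral>\<^sup>+t. tail M (\<lambda>_. 1) t epowr (a - 1) \<partial>M)"
    unfolding N_def by (subst nn_integral_distr) auto
  finally show ?thesis
    using N.integral_distribution_fun_powr[OF a] by (simp add: N_def emeasure_distr)
qed

lemma tail_powr:
  assumes [measurable]: "f \<in> borel_measurable M" and fin: "(\<integral>\<^sup>+x. f x \<partial>M) < \<infinity>" and a: "0 < a"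
  shows "tail M f x epowr a = ennreal a * tail M (\<lambda>t. tail M f t epowr (a - 1) * f t) x"
proof -
  define h where "h = (\<lambda>t. f t * indicator {x..} t)"
  have [measurable]: "h \<in> borel_measurable M" unfolding h_def by measurable
  define N where "N = density M h"
  have "(\<integral>\<^sup>+x. h x \<partial>M) < \<infinity>"
    using le_less_trans[OF tail_le_integral[of M f x] fin] by (simp add: h_def tail_def)
  then interpret N: diffuse_measure N
    unfolding N_def by (intro density_diffuse) auto
  have total: "emeasure N (space N) = tail M f x"
    by (simp add: N_def emeasure_density h_def tail_def cong: nn_integral_cong)
  have V: "tail N (\<lambda>_. 1) t = tail M f t" if "x \<le> t" for t
    unfolding N_def using that
    by (subst tail_density) (auto simp: h_def tail_def indicator_def intro!: nn_integral_cong)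
  have "(\<integral>\<^sup>+t. tail N (\<lambda>_. 1) t epowr (a - 1) \<partial>N) = (\<integral>\<^sup>+t. h t * tail N (\<lambda>_. 1) t epowr (a - 1) \<partial>M)"
  proof -
    have "(\<lambda>t. tail N (\<lambda>_. 1) t) \<in> borel_measurable M"
      by measurable
    then show ?thesis unfolding N_def by (subst nn_integral_density) auto
  qed
  also have "\<dots> = tail M (\<lambda>t. tail M f t epowr (a - 1) * f t) x"
    unfolding tail_def[of M "\<lambda>t. tail M f t epowr (a - 1) * f t"]
    by (intro nn_integral_cong) (auto simp: h_def V indicator_def mult.commute)
  finally show ?thesis
    using N.integral_tail_powr[OF a] by (simp add: total)
qed

lemma distribution_fun_finite [simp]: "distribution_fun M x < top"
  using cumul_le_integral[of M "\<lambda>_. 1" x] by (simp add: emeasure_eq_measure) (meson ennreal_less_top le_less_trans)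

lemma distribution_fun_pos: "AE x in M. 0 < distribution_fun M x"
proof -
  have "(\<integral>\<^sup>+t. indicator {0} (distribution_fun M t) \<partial>M)
      = (\<integral>\<^sup>+s. indicator {0} (ennreal s) * indicator {0..measure M (space M)} s \<partial>lborel)"
    by (rule distr_distribution_fun) measurable
  also have "\<dots> = (\<integral>\<^sup>+(s::real). 0 \<partial>lborel)"
    by (intro nn_integral_cong_AE eventually_mono[OF AE_lborel_singleton[of 0]])
       (auto simp: indicator_def ennreal_eq_0_iff)
  finally have "(\<integral>\<^sup>+t. indicator {0} (distribution_fun M t) \<partial>M) = 0"
    by simp
  then have "AE x in M. indicator {0} (distribution_fun M x) = (0::ennreal)"
    by (subst (asm) nn_integral_0_iff_AE) auto
  then show ?thesis
    by (auto simp: indicator_def zero_less_iff_neq_zero elim: eventually_mono)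
qed

text \<open>
  The change of variables bounds the integral by that of \<open>s^(-b)\<close> over \<open>[V(s), \<infinity>)\<close>, where \<open>V\<close> is the
  distribution function. It is only an inequality because the total mass of \<open>M\<close> is finite.
\<close>

lemma tail_distribution_fun_powr_le:
  assumes b: "1 < b"
  shows "tail M (\<lambda>t. distribution_fun M t epowr (- b)) s \<le> ennreal (1 / (b - 1)) * distribution_fun M s epowr (1 - b)"
proof (cases "distribution_fun M s" rule: ennreal_zero_top_pos_cases)
  case 1
  then show ?thesis using b by (simp add: epowr_def ennreal_mult_top)
next
  case 2
  then show ?thesis using distribution_fun_finite[of s] by simp
next
  case (3 v)
  have "tail M (\<lambda>t. distribution_fun M t epowr (- b)) s
      \<le> (\<integral>\<^sup>+t. distribution_fun M t epowr (- b) * indicator {ennreal v..} (distribution_fun M t) \<partial>M)"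
    unfolding tail_def 
    using cumul_mono[of s _ M "\<lambda>_. 1"] 3 by (intro nn_integral_mono) (auto simp: indicator_def)
  also have "\<dots> = (\<integral>\<^sup>+s. (ennreal s epowr (- b) * indicator {ennreal v..} (ennreal s))
                    * indicator {0..measure M (space M)} s \<partial>lborel)"
    by (rule distr_distribution_fun) measurable
  also have "\<dots> \<le> (\<integral>\<^sup>+s. ennreal (if s \<in> {v..} then s powr (- b) else 0) \<partial>lborel)"
    using 3 by (intro nn_integral_mono) (auto simp: indicator_def epowr_ennreal)
  also have "\<dots> = ennreal (- (v powr (- b + 1)) / (- b + 1))"
  proof (rule nn_integral_has_integral_lborel)
    show "((\<lambda>s. if s \<in> {v..} then s powr (- b) else 0) has_integral - (v powr (- b + 1)) / (- b + 1)) UNIV"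
      unfolding has_integral_restrict_UNIV using b 3 by (intro has_integral_powr_to_inf) auto
  qed auto
  also have "\<dots> = ennreal (1 / (b - 1)) * distribution_fun M s epowr (1 - b)"
    using b 3 by (simp add: epowr_ennreal field_simps flip: ennreal_mult)
  finally show ?thesis .
qed

text \<open>
  Both sides integrate \<open>f(s) g(t)\<close> over the half-plane \<open>s \<le> t\<close>: the running integral and the tail are
  adjoint to each other.
\<close>

lemma integral_cumul_eq_integral_tail:
  assumes "diffuse_measure N" and [measurable]: "f \<in> borel_measurable M" "g \<in> borel_measurable N"
  shows "(\<integral>\<^sup>+t. g t * cumul M f t \<partial>N) = (\<integral>\<^sup>+s. f s * tail N g s \<partial>M)"
proof -
  interpret N: diffuse_measure N by fact
  interpret P: pair_sigma_finite M N ..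
  have [measurable]: "Measurable.pred (M \<Otimes>\<^sub>M N) (\<lambda>x. fst x \<le> snd x)"
    by measurable
  have "(\<integral>\<^sup>+t. g t * cumul M f t \<partial>N) = (\<integral>\<^sup>+t. \<integral>\<^sup>+s. (if s \<le> t then f s * g t else 0) \<partial>M \<partial>N)"
    unfolding cumul_def
    by (subst nn_integral_cmult[symmetric]) (auto intro!: nn_integral_cong simp: indicator_def mult.commute)
  also have "\<dots> = (\<integral>\<^sup>+s. \<integral>\<^sup>+t. (if s \<le> t then f s * g t else 0) \<partial>N \<partial>M)"
    by (rule P.Fubini') measurable
  also have "\<dots> = (\<integral>\<^sup>+s. f s * tail N g s \<partial>M)"
    unfolding tail_def
    by (subst nn_integral_cmult[symmetric]) (auto intro!: nn_integral_cong simp: indicator_def)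
  finally show ?thesis .
qed

end

section \<open>The Hardy inequality and the basic one-term estimate\<close>

context diffuse_measure
begin

lemma cumul_le_norm:
  assumes [measurable]: "f \<in> borel_measurable M" and p: "1 < p"
  shows "cumul M f x \<le> (\<integral>\<^sup>+t. f t epowr p \<partial>M) epowr (1 / p) * distribution_fun M x epowr (1 - 1 / p)"
proof -
  have "cumul M f x = cumul M (\<lambda>t. (f t epowr p) epowr (1 / p) * 1 epowr (1 - 1 / p)) x"
    using p by simp
  also have "\<dots> \<le> cumul M (\<lambda>t. f t epowr p) x epowr (1 / p) * distribution_fun M x epowr (1 - 1 / p)"
    using p by (intro cumul_Holder) auto
  also have "\<dots> \<le> (\<integral>\<^sup>+t. f t epowr p \<partial>M) epowr (1 / p) * distribution_fun M x epowr (1 - 1 / p)"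
    using p by (intro mult_right_mono epowr_mono cumul_le_integral) auto
  finally show ?thesis .
qed

text \<open>
  The Hardy inequality for averages with respect to \<open>M\<close>, with the sharp constant \<open>p'^p\<close>. The proof
  inserts the powers \<open>V^(b/p)\<close> and \<open>V^(-b/p)\<close> with \<open>b = 1/p'\<close> under the running integral, applies the Hoelder
  inequality and exchanges the order of integration. This choice of the exponent makes the two remaining integrals
  of powers of \<open>V\<close> converge, and no norm has to be cancelled, so that infinite norms are covered too.
\<close>

lemma Hardy_average:
  assumes [measurable]: "f \<in> borel_measurable M" and p: "1 < p"
  shows "(\<integral>\<^sup>+t. (cumul M f t * distribution_fun M t epowr -1) epowr p \<partial>M)
      \<le> ennreal ((p / (p - 1)) powr p) * (\<integral>\<^sup>+t. f t epowr p \<partial>M)"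
proof -
  define b where "b = 1 - 1 / p"
  define c where "c = p / (p - 1)"
  have b: "0 < b" "b < 1" "1 / p = 1 - b" "b * p = p - 1" using p by (auto simp: b_def field_simps)
  have c: "0 < c" "c * b = 1" "1 / b = c" using p by (auto simp: c_def b_def field_simps)
  define V where "V = distribution_fun M"
  have V[measurable]: "V \<in> borel_measurable M" unfolding V_def by measurable
  have Vfin: "V t < top" for t by (simp add: V_def)
  have Vpos: "AE t in M. 0 < V t" unfolding V_def by (rule distribution_fun_pos)
  define J where "J = cumul M (\<lambda>s. f s epowr p * V s epowr b)"
  have V_int: "cumul M (\<lambda>s. V s epowr (b - 1)) t = ennreal c * V t epowr b" for t
  proof -
    have "V t epowr b = ennreal b * cumul M (\<lambda>s. V s epowr (b - 1)) t"
      using cumul_powr[of "\<lambda>_. 1" b t] b by (simp add: V_def emeasure_eq_measure)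
    then show ?thesis
      using b c by (simp add: mult.assoc[symmetric] flip: ennreal_mult)
  qed
  have F: "cumul M f t \<le> J t epowr (1 / p) * (ennreal c * V t epowr b) epowr b" for t
  proof -
    have "cumul M f t = cumul M (\<lambda>s. (f s epowr p * V s epowr b) epowr (1 / p) * (V s epowr (b - 1)) epowr b) t"
    proof (rule cumul_cong_AE)
      show "AE s in M. f s = (f s epowr p * V s epowr b) epowr (1 / p) * (V s epowr (b - 1)) epowr b"
        using Vpos
      proof eventually_elim
        case (elim s)
        have "V s epowr (b / p) * V s epowr ((b - 1) * b) = V s epowr (b / p + (b - 1) * b)"
          using elim Vfin by (simp add: epowr_add_pos_fin)
        also have "b / p + (b - 1) * b = 0"
          using b(3) by (simp only: divide_inverse[of b] inverse_eq_divide) (simp add: algebra_simps)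
        finally show ?case
          using p by (simp add: epowr_mult mult.assoc)
      qed
    qed
    also have "\<dots> \<le> J t epowr (1 / p) * cumul M (\<lambda>s. V s epowr (b - 1)) t epowr b"
      unfolding J_def using p b by (intro cumul_Holder) auto
    finally show ?thesis by (simp add: V_int)
  qed
  have "(\<integral>\<^sup>+t. (cumul M f t * V t epowr -1) epowr p \<partial>M)
      \<le> (\<integral>\<^sup>+t. ennreal (c powr (p - 1)) * (V t epowr (- (1 + b)) * J t) \<partial>M)"
  proof (rule nn_integral_mono_AE)
    show "AE t in M. (cumul M f t * V t epowr -1) epowr p \<le> ennreal (c powr (p - 1)) * (V t epowr (- (1 + b)) * J t)"
      using Vpos
    proof eventually_elim
      case (elim t)
      have "(cumul M f t * V t epowr -1) epowr p
          \<le> (J t epowr (1 / p) * (ennreal c * V t epowr b) epowr b * V t epowr -1) epowr p"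
        using p by (intro epowr_mono mult_right_mono F) auto
      also have "\<dots> = ennreal (c powr (p - 1)) * (J t * (V t epowr (b * b * p) * V t epowr (- p)))"
        using p c b(1,4) by (simp add: epowr_mult epowr_ennreal powr_powr mult.assoc mult.left_commute)
      also have "V t epowr (b * b * p) * V t epowr (- p) = V t epowr (b * b * p + - p)"
        using elim Vfin by (simp only: epowr_add_pos_fin)
      also have "b * b * p + - p = - (1 + b)"
      proof -
        have "b * b * p = b * (p - 1)" by (simp only: mult.assoc b(4))
        also have "\<dots> = b * p - b" by (simp add: right_diff_distrib)
        finally show ?thesis using b(4) by linarith
      qed
      finally show ?case by (simp add: mult.commute)
    qed
  qed
  also have "\<dots> = ennreal (c powr (p - 1)) * (\<integral>\<^sup>+t. V t epowr (- (1 + b)) * J t \<partial>M)"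
    by (rule nn_integral_cmult) (simp add: J_def)
  also have "(\<integral>\<^sup>+t. V t epowr (- (1 + b)) * J t \<partial>M)
     = (\<integral>\<^sup>+s. (f s epowr p * V s epowr b) * tail M (\<lambda>t. V t epowr (- (1 + b))) s \<partial>M)"
    unfolding J_def by (rule integral_cumul_eq_integral_tail) (auto intro: diffuse_measure_axioms)
  also have "\<dots> \<le> (\<integral>\<^sup>+s. ennreal c * f s epowr p \<partial>M)"
  proof (rule nn_integral_mono_AE)
    show "AE s in M. (f s epowr p * V s epowr b) * tail M (\<lambda>t. V t epowr (- (1 + b))) s \<le> ennreal c * f s epowr p"
      using Vpos
    proof eventually_elim
      case (elim s)
      have "(f s epowr p * V s epowr b) * tail M (\<lambda>t. V t epowr (- (1 + b))) s
          \<le> (f s epowr p * V s epowr b) * (ennreal c * V s epowr (- b))"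
        using tail_distribution_fun_powr_le[of "1 + b" s] b c
        by (intro mult_left_mono) (auto simp: V_def)
      also have "\<dots> = ennreal c * f s epowr p * (V s epowr b * V s epowr (- b))"
        by (simp add: ac_simps)
      finally show ?case using epowr_cancel[OF elim Vfin] by simp
    qed
  qed
  also have "\<dots> = ennreal c * (\<integral>\<^sup>+s. f s epowr p \<partial>M)"
    by (rule nn_integral_cmult) measurable
  also have "ennreal (c powr (p - 1)) * (ennreal c * (\<integral>\<^sup>+s. f s epowr p \<partial>M))
      = ennreal (c powr p) * (\<integral>\<^sup>+s. f s epowr p \<partial>M)"
    using c by (simp add: powr_diff mult.assoc[symmetric] flip: ennreal_mult)
  finally show ?thesis
    by (simp add: V_def c_def mult_left_mono)
qed

text \<open>
  Write \<open>F = R V\<close> with the average \<open>R\<close>. Of the \<open>q - 1\<close> factors \<open>F\<close>, the surplus \<open>q - p\<close> is bounded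
  pointwise by the norm of \<open>f\<close>, and \<open>R^(p-1) f\<close> is integrated by the Hoelder inequality and the
  Hardy inequality. The powers of \<open>V\<close> add up to \<open>q(1 - 1/p)\<close>.
\<close>

lemma Hardy_term_bound_le:
  assumes [measurable]: "f \<in> borel_measurable M" "w \<in> borel_measurable M"
    and p: "1 < p" and q: "p \<le> q"
    and S: "AE t in M. w t * distribution_fun M t epowr (q * (1 - 1 / p)) \<le> S"
  shows "(\<integral>\<^sup>+t. w t * cumul M f t epowr (q - 1) * f t \<partial>M)
      \<le> ennreal ((p / (p - 1)) powr p) * (\<integral>\<^sup>+t. f t epowr p \<partial>M) epowr (q / p) * S"
proof -
  define b where "b = 1 - 1 / p"
  define c where "c = p / (p - 1)"
  have b: "0 < b" "1 / p = 1 - b" "b * p = p - 1" "p * b = p - 1" using p by (auto simp: b_def field_simps)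
  have c: "1 \<le> c" using p by (auto simp: c_def field_simps)
  define V where "V = distribution_fun M"
  have V[measurable]: "V \<in> borel_measurable M" unfolding V_def by measurable
  have Vfin: "V t < top" for t by (simp add: V_def)
  have Vpos: "AE t in M. 0 < V t" unfolding V_def by (rule distribution_fun_pos)
  define X where "X = (\<integral>\<^sup>+t. f t epowr p \<partial>M)"
  define R where "R = (\<lambda>t. cumul M f t * V t epowr -1)"
  have [measurable]: "R \<in> borel_measurable M" unfolding R_def by measurable
  have "(\<integral>\<^sup>+t. w t * cumul M f t epowr (q - 1) * f t \<partial>M)
      \<le> (\<integral>\<^sup>+t. (X epowr ((q - p) / p) * S) * ((R t epowr p) epowr b * (f t epowr p) epowr (1 / p)) \<partial>M)"
  proof (rule nn_integral_mono_AE)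
    show "AE t in M. w t * cumul M f t epowr (q - 1) * f t
      \<le> (X epowr ((q - p) / p) * S) * ((R t epowr p) epowr b * (f t epowr p) epowr (1 / p))"
      using Vpos S
    proof eventually_elim
      case (elim t)
      have FR: "cumul M f t = R t * V t"
        using epowr_cancel[OF elim(1) Vfin, of "-1"] by (simp add: R_def mult.assoc)
      have "cumul M f t epowr (q - 1) = cumul M f t epowr (q - p) * cumul M f t epowr (p - 1)"
        using p q by (simp flip: epowr_add)
      also have "\<dots> \<le> (X epowr (1 / p) * V t epowr b) epowr (q - p) * cumul M f t epowr (p - 1)"
        using p q cumul_le_norm[of f p t] 
        by (intro mult_right_mono epowr_mono) (auto simp: X_def V_def b_def)
      also have "\<dots> = X epowr ((q - p) / p) * (V t epowr (b * (q - p)) * V t epowr (p - 1)) * R t epowr (p - 1)"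
        using p q by (simp add: FR epowr_mult ac_simps)
      also have "V t epowr (b * (q - p)) * V t epowr (p - 1) = V t epowr (b * (q - p) + (p - 1))"
        using p q b(1) by (intro epowr_add[symmetric] mult_nonneg_nonneg) auto
      also have "b * (q - p) + (p - 1) = q * b"
        using b(3) by (simp add: algebra_simps)
      finally have "w t * cumul M f t epowr (q - 1) * f t
          \<le> w t * (X epowr ((q - p) / p) * V t epowr (q * b) * R t epowr (p - 1)) * f t"
        by (intro mult_left_mono mult_right_mono) auto
      also have "\<dots> = X epowr ((q - p) / p) * (w t * V t epowr (q * b)) * (R t epowr (p - 1) * f t)"
        by (simp add: ac_simps)
      also have "\<dots> \<le> X epowr ((q - p) / p) * S * (R t epowr (p - 1) * f t)"
        using elim(2) by (intro mult_left_mono mult_right_mono) (auto simp: V_def b_def)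
      finally show ?case using p by (simp add: b(4))
    qed
  qed
  also have "\<dots> = X epowr ((q - p) / p) * S * (\<integral>\<^sup>+t. (R t epowr p) epowr b * (f t epowr p) epowr (1 / p) \<partial>M)"
    by (rule nn_integral_cmult) measurable
  also have "\<dots> \<le> X epowr ((q - p) / p) * S * ((\<integral>\<^sup>+t. R t epowr p \<partial>M) epowr b * X epowr (1 / p))"
    unfolding X_def using b(1) p by (intro mult_left_mono Holder_nn_integral) (auto simp: b_def)
  also have "\<dots> \<le> X epowr ((q - p) / p) * S * ((ennreal (c powr p) * X) epowr b * X epowr (1 / p))"
    unfolding R_def V_def X_def c_def using b 
    by (intro mult_left_mono mult_right_mono epowr_mono Hardy_average p) auto
  also have "\<dots> = ennreal (c powr (p - 1)) * (X epowr ((q - p) / p) * X epowr b * X epowr (1 / p)) * S"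
    using b c by (simp add: epowr_mult epowr_ennreal powr_powr ac_simps)
  also have "X epowr ((q - p) / p) * X epowr b * X epowr (1 / p) = X epowr ((q - p) / p + b + 1 / p)"
    using epowr_add[of "(q - p) / p" b X] epowr_add[of "(q - p) / p + b" "1 / p" X] p q b(1) by simp
  also have "(q - p) / p + b + 1 / p = q / p"
    using p by (simp add: b_def field_simps)
  also have "ennreal (c powr (p - 1)) * X epowr (q / p) * S \<le> ennreal (c powr p) * X epowr (q / p) * S"
    using c by (intro mult_right_mono ennreal_leI powr_mono) auto
  finally show ?thesis by (simp add: X_def c_def)
qed

text \<open>
  For \<open>q < p\<close> there are not enough factors \<open>F\<close> for a pointwise bound. Instead the Hoelder inequality
  is applied to \<open>w V^(q-1)\<close>, \<open>R^(q-1)\<close> and \<open>f\<close>, where \<open>R = F / V\<close>, with exponents \<open>r/q\<close>, \<open>p/(q-1)\<close> and \<open>p\<close>;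
  their reciprocals add up to \<open>1\<close> by the definition of \<open>r\<close>.
\<close>

lemma Hardy_term_bound_gt:
  assumes [measurable]: "f \<in> borel_measurable M" "w \<in> borel_measurable M"
    and q: "1 < q" "q < p" and r: "1 / r = 1 / q - 1 / p"
  shows "(\<integral>\<^sup>+t. w t * cumul M f t epowr (q - 1) * f t \<partial>M)
      \<le> ennreal ((p / (p - 1)) powr p) * (\<integral>\<^sup>+t. f t epowr p \<partial>M) epowr (q / p) *
         (\<integral>\<^sup>+t. w t epowr (r / q) * distribution_fun M t epowr (r * (1 - 1 / q)) \<partial>M) epowr (q / r)"
proof -
  define c where "c = p / (p - 1)"
  have p: "1 < p" using q by simp
  have c: "1 \<le> c" using p by (auto simp: c_def field_simps)
  have "0 < 1 / r" unfolding r using q by (simp add: field_simps)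
  then have r0: "0 < r" by simp
  have qr: "q / r = 1 - q / p"
    using r q p r0 by (simp add: field_simps)
  define V where "V = distribution_fun M"
  have V[measurable]: "V \<in> borel_measurable M" unfolding V_def by measurable
  have Vfin: "V t < top" for t by (simp add: V_def)
  have Vpos: "AE t in M. 0 < V t" unfolding V_def by (rule distribution_fun_pos)
  define X where "X = (\<integral>\<^sup>+t. f t epowr p \<partial>M)"
  define R where "R = (\<lambda>t. cumul M f t * V t epowr -1)"
  have [measurable]: "R \<in> borel_measurable M" unfolding R_def by measurable
  define W where "W = (\<lambda>t. w t epowr (r / q) * V t epowr (r * (1 - 1 / q)))"
  have [measurable]: "W \<in> borel_measurable M" unfolding W_def by measurable
  have "(\<integral>\<^sup>+t. w t * cumul M f t epowr (q - 1) * f t \<partial>M)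
      = (\<integral>\<^sup>+t. W t epowr (q / r) * (R t epowr p) epowr ((q - 1) / p) * (f t epowr p) epowr (1 / p) \<partial>M)"
  proof (rule nn_integral_cong_AE)
    show "AE t in M. w t * cumul M f t epowr (q - 1) * f t
      = W t epowr (q / r) * (R t epowr p) epowr ((q - 1) / p) * (f t epowr p) epowr (1 / p)"
      using Vpos
    proof eventually_elim
      case (elim t)
      have FR: "cumul M f t = R t * V t"
        using epowr_cancel[OF elim(1) Vfin, of "-1"] by (simp add: R_def mult.assoc)
      have "(1 - 1 / q) * q = q - 1" using q by (simp add: field_simps)
      then show ?case
        using q p r0 by (simp add: FR W_def epowr_mult ac_simps)
    qed
  qed
  also have "\<dots> \<le> (\<integral>\<^sup>+t. W t \<partial>M) epowr (q / r) * (\<integral>\<^sup>+t. R t epowr p \<partial>M) epowr ((q - 1) / p) * X epowr (1 / p)"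
    unfolding X_def using q p r0 qr
    by (intro Holder_nn_integral3) (auto simp: diff_divide_distrib divide_strict_right_mono)
  also have "\<dots> \<le> (\<integral>\<^sup>+t. W t \<partial>M) epowr (q / r) * (ennreal (c powr p) * X) epowr ((q - 1) / p) * X epowr (1 / p)"
    unfolding R_def V_def X_def c_def using q p
    by (intro mult_left_mono mult_right_mono epowr_mono Hardy_average p) auto
  also have "\<dots> = ennreal (c powr (q - 1)) * (X epowr ((q - 1) / p) * X epowr (1 / p)) * (\<integral>\<^sup>+t. W t \<partial>M) epowr (q / r)"
    using q p c by (simp add: epowr_mult epowr_ennreal powr_powr ac_simps)
  also have "X epowr ((q - 1) / p) * X epowr (1 / p) = X epowr ((q - 1) / p + 1 / p)"
    using p q by (intro epowr_add[symmetric]) auto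
  also have "(q - 1) / p + 1 / p = q / p"
    using p by (simp add: field_simps)
  also have "ennreal (c powr (q - 1)) * X epowr (q / p) * (\<integral>\<^sup>+t. W t \<partial>M) epowr (q / r)
      \<le> ennreal (c powr p) * X epowr (q / p) * (\<integral>\<^sup>+t. W t \<partial>M) epowr (q / r)"
    using c q by (intro mult_right_mono ennreal_leI powr_mono) auto
  finally show ?thesis by (simp add: X_def c_def W_def V_def)
qed

end

section \<open>Splitting the bilinear integral\<close>

context diffuse_measure
begin

lemma integral_cumul_powr:
  assumes N: "diffuse_measure N" and [measurable]: "f \<in> borel_measurable M" "w \<in> borel_measurable N"
    and fin: "(\<integral>\<^sup>+t. f t \<partial>M) < \<infinity>" and q: "0 < q"
  shows "(\<integral>\<^sup>+x. w x * cumul M f x epowr q \<partial>N)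
       = ennreal q * (\<integral>\<^sup>+t. tail N w t * cumul M f t epowr (q - 1) * f t \<partial>M)"
proof -
  interpret N: diffuse_measure N by fact
  have "(\<integral>\<^sup>+x. w x * cumul M f x epowr q \<partial>N)
      = (\<integral>\<^sup>+x. ennreal q * (w x * cumul M (\<lambda>t. cumul M f t epowr (q - 1) * f t) x) \<partial>N)"
    using q fin by (subst cumul_powr[where a = q]) (auto intro!: nn_integral_cong simp: ac_simps)
  also have "\<dots> = ennreal q * (\<integral>\<^sup>+x. w x * cumul M (\<lambda>t. cumul M f t epowr (q - 1) * f t) x \<partial>N)"
    by (rule nn_integral_cmult) measurable
  also have "(\<integral>\<^sup>+x. w x * cumul M (\<lambda>t. cumul M f t epowr (q - 1) * f t) x \<partial>N)
      = (\<integral>\<^sup>+t. tail N w t * cumul M f t epowr (q - 1) * f t \<partial>M)"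
    by (subst integral_cumul_eq_integral_tail[OF N]) (auto intro!: nn_integral_cong simp: ac_simps)
  finally show ?thesis .
qed

text \<open>
  The product rule, as an inequality: the square \<open>s, t \<le> x\<close> is covered by the two triangles
  \<open>t \<le> s \<le> x\<close> and \<open>s \<le> t \<le> x\<close>.
\<close>

lemma cumul_mult_le:
  assumes N: "diffuse_measure N" and [measurable]: "f \<in> borel_measurable M" "g \<in> borel_measurable N"
  shows "cumul M f x * cumul N g x
      \<le> cumul M (\<lambda>s. f s * cumul N g s) x + cumul N (\<lambda>t. g t * cumul M f t) x"
proof -
  interpret N: diffuse_measure N by fact
  define f' where "f' = (\<lambda>s. f s * indicator {..x} s)"
  define g' where "g' = (\<lambda>t. g t * indicator {..x} t)"
  have [measurable]: "f' \<in> borel_measurable M" "g' \<in> borel_measurable N"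
    unfolding f'_def g'_def by measurable
  have split: "cumul N g x \<le> cumul N g s + tail N g' s" for s
  proof -
    have "cumul N g x \<le> (\<integral>\<^sup>+t. g t * indicator {..s} t + g' t * indicator {s..} t \<partial>N)"
      unfolding cumul_def g'_def by (intro nn_integral_mono) (auto simp: indicator_def)
    also have "\<dots> = cumul N g s + tail N g' s"
      unfolding cumul_def tail_def by (rule nn_integral_add) measurable
    finally show ?thesis .
  qed
  have "cumul M f x * cumul N g x = (\<integral>\<^sup>+s. f' s * cumul N g x \<partial>M)"
    unfolding cumul_def[of M] f'_def by (rule nn_integral_multc[symmetric]) measurable
  also have "\<dots> \<le> (\<integral>\<^sup>+s. f' s * cumul N g s + f' s * tail N g' s \<partial>M)"
    by (intro nn_integral_mono) (auto simp flip: distrib_left intro!: mult_left_mono split)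
  also have "\<dots> = (\<integral>\<^sup>+s. f' s * cumul N g s \<partial>M) + (\<integral>\<^sup>+s. f' s * tail N g' s \<partial>M)"
    by (rule nn_integral_add) measurable
  also have "(\<integral>\<^sup>+s. f' s * tail N g' s \<partial>M) = (\<integral>\<^sup>+t. g' t * cumul M f' t \<partial>N)"
    by (rule integral_cumul_eq_integral_tail[OF N, symmetric]) measurable
  also have "\<dots> = cumul N (\<lambda>t. g t * cumul M f t) x"
  proof -
    have "cumul M f' t = cumul M f t" if "t \<le> x" for t
      unfolding cumul_def f'_def using that by (intro nn_integral_cong) (auto simp: indicator_def)
    then show ?thesis
      unfolding cumul_def[of N] by (intro nn_integral_cong) (auto simp: g'_def indicator_def)
  qed
  also have "(\<integral>\<^sup>+s. f' s * cumul N g s \<partial>M) = cumul M (\<lambda>s. f s * cumul N g s) x"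
    unfolding cumul_def[of M] f'_def by (intro nn_integral_cong) (auto simp: ac_simps)
  finally show ?thesis .
qed

text \<open>
  The chain rule writes \<open>F^q\<close> and \<open>G^q\<close> as running integrals, the product rule splits their product,
  and the exchange of order of integration replaces the integral against \<open>N\<close> by its tail.
\<close>

lemma integral_product_powr_le:
  assumes "diffuse_measure M'" "diffuse_measure N"
    and [measurable]: "f \<in> borel_measurable M" "g \<in> borel_measurable M'"
    and fin: "(\<integral>\<^sup>+t. f t \<partial>M) < \<infinity>" "(\<integral>\<^sup>+t. g t \<partial>M') < \<infinity>" and q: "0 < q"
  shows "(\<integral>\<^sup>+x. (cumul M f x * cumul M' g x) epowr q \<partial>N)
    \<le> ennreal q * (\<integral>\<^sup>+t. (tail N (\<lambda>_. 1) t * cumul M' g t epowr q) * cumul M f t epowr (q - 1) * f t \<partial>M)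
    + ennreal q * (\<integral>\<^sup>+t. (tail N (\<lambda>_. 1) t * cumul M f t epowr q) * cumul M' g t epowr (q - 1) * g t \<partial>M')"
proof -
  interpret M': diffuse_measure M' by fact
  interpret N: diffuse_measure N by fact
  define F where "F = cumul M f"
  define G where "G = cumul M' g"
  have meas: "F \<in> borel_measurable L" "G \<in> borel_measurable L" if "(\<lambda>x. x) \<in> borel_measurable L" for L
    using that unfolding F_def G_def by measurable
  note [measurable] = meas[OF ident_measurable] meas[OF M'.ident_measurable] meas[OF N.ident_measurable]
  define f' where "f' = (\<lambda>t. F t epowr (q - 1) * f t)"
  define g' where "g' = (\<lambda>t. G t epowr (q - 1) * g t)"
  have [measurable]: "f' \<in> borel_measurable M" "g' \<in> borel_measurable M'"
    unfolding f'_def g'_def by measurable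
  have F: "F x epowr q = ennreal q * cumul M f' x" for x
    unfolding F_def f'_def using fin q by (intro cumul_powr) auto
  have G: "G x epowr q = ennreal q * cumul M' g' x" for x
    unfolding G_def g'_def using fin q by (intro M'.cumul_powr) auto
  have "(F x * G x) epowr q \<le> ennreal q * cumul M (\<lambda>t. f' t * G t epowr q) x
                            + ennreal q * cumul M' (\<lambda>t. g' t * F t epowr q) x" for x
  proof -
    have "(F x * G x) epowr q = ennreal q * ennreal q * (cumul M f' x * cumul M' g' x)"
      using q by (simp add: epowr_mult F G ac_simps)
    also have "\<dots> \<le> ennreal q * ennreal q *
        (cumul M (\<lambda>s. f' s * cumul M' g' s) x + cumul M' (\<lambda>t. g' t * cumul M f' t) x)"
      using cumul_mult_le[OF \<open>diffuse_measure M'\<close>, of f' g' x] by (intro mult_left_mono) auto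
    also have "\<dots> = ennreal q * (ennreal q * cumul M (\<lambda>s. f' s * cumul M' g' s) x)
                   + ennreal q * (ennreal q * cumul M' (\<lambda>t. g' t * cumul M f' t) x)"
      by (simp add: distrib_left mult.assoc)
    also have "\<dots> = ennreal q * cumul M (\<lambda>t. f' t * G t epowr q) x
                   + ennreal q * cumul M' (\<lambda>t. g' t * F t epowr q) x"
      by (subst (1 2) cumul_cmult[symmetric]) (auto simp: F G ac_simps)
    finally show ?thesis .
  qed
  then have "(\<integral>\<^sup>+x. (F x * G x) epowr q \<partial>N)
     \<le> (\<integral>\<^sup>+x. ennreal q * cumul M (\<lambda>t. f' t * G t epowr q) x
             + ennreal q * cumul M' (\<lambda>t. g' t * F t epowr q) x \<partial>N)"
    by (intro nn_integral_mono)
  also have "\<dots> = ennreal q * (\<integral>\<^sup>+x. 1 * cumul M (\<lambda>t. f' t * G t epowr q) x \<partial>N)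
                + ennreal q * (\<integral>\<^sup>+x. 1 * cumul M' (\<lambda>t. g' t * F t epowr q) x \<partial>N)"
    by (simp add: nn_integral_add nn_integral_cmult)
  also have "\<dots> = ennreal q * (\<integral>\<^sup>+t. f' t * G t epowr q * tail N (\<lambda>_. 1) t \<partial>M)
                + ennreal q * (\<integral>\<^sup>+t. g' t * F t epowr q * tail N (\<lambda>_. 1) t \<partial>M')"
    by (subst integral_cumul_eq_integral_tail[OF \<open>diffuse_measure N\<close>], measurable)
       (subst M'.integral_cumul_eq_integral_tail[OF \<open>diffuse_measure N\<close>], measurable)
  finally show ?thesis
    by (simp add: F_def G_def f'_def g'_def ac_simps)
qed

end

section \<open>Upper bounds for the bilinear Hardy constant\<close>

lemma r_exp_pos: "0 < q \<Longrightarrow> q < p \<Longrightarrow> 0 < r_exp q p"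
  by (simp add: r_exp_def frac_less2)

lemma r_exp_gt: 
  assumes "0 < q" "q < p"
  shows "q < r_exp q p"
proof -
  have "1 / r_exp q p < 1 / q" using assms by (simp add: r_exp_def)
  then show ?thesis using r_exp_pos[OF assms] assms by (simp add: field_simps)
qed

text \<open>
  An upper bound for all the powers \<open>p'^(p-1)\<close>, \<open>p'^(q-1)\<close> that occur, so that the cases \<open>p \<le> q\<close>
  and \<open>q < p\<close> share one constant.
\<close>

definition hardy_const :: "real \<Rightarrow> real" where
  "hardy_const p = (p / (p - 1)) powr p"

text \<open>
  For \<open>r = r_exp q p\<close> and \<open>M = \<sigma> dx\<close> this is the density, relative to \<open>M\<close>, that is integrated over
  \<open>[x,d]\<close> in \<open>A\<^sub>2\<close> to \<open>A\<^sub>7\<close>.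
\<close>

definition inner_weight :: "real measure \<Rightarrow> real measure \<Rightarrow> real \<Rightarrow> real \<Rightarrow> real \<Rightarrow> ennreal" where
  "inner_weight N M q r t = tail N (\<lambda>_. 1) t epowr (r / q) * distribution_fun M t epowr (r * (1 - 1 / q))"

definition Lp_norm :: "real measure \<Rightarrow> real \<Rightarrow> (real \<Rightarrow> ennreal) \<Rightarrow> ennreal" where
  "Lp_norm M p f = (\<integral>\<^sup>+t. f t epowr p \<partial>M) epowr (1 / p)"

text \<open>
  One of the two summands in \<open>integral_product_powr_le\<close>. Its weight, the product of the tail of \<open>N\<close> with
  \<open>G^q\<close>, is a factor of its own so that the one-term estimates apply to it.
\<close>

definition Hardy_term ::
  "real measure \<Rightarrow> real measure \<Rightarrow> real measure \<Rightarrow> real \<Rightarrow> (real \<Rightarrow> ennreal) \<Rightarrow> (real \<Rightarrow> ennreal) \<Rightarrow> ennreal" where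
  "Hardy_term M M' N q f g =
     (\<integral>\<^sup>+t. (tail N (\<lambda>_. 1) t * cumul M' g t epowr q) * cumul M f t epowr (q - 1) * f t \<partial>M)"

definition Hardy_term_bounded ::
  "real measure \<Rightarrow> real measure \<Rightarrow> real measure \<Rightarrow> real \<Rightarrow> real \<Rightarrow> real \<Rightarrow> real \<Rightarrow> ennreal \<Rightarrow> bool" where
  "Hardy_term_bounded M M' N p p' q k A \<longleftrightarrow>
     (\<forall>f\<in>borel_measurable M. \<forall>g\<in>borel_measurable M'.
        Lp_norm M p f < \<infinity> \<longrightarrow> Lp_norm M' p' g < \<infinity> \<longrightarrow>
        Hardy_term M M' N q f g \<le> ennreal k * (Lp_norm M p f * Lp_norm M' p' g * A) epowr q)"

lemma Hardy_term_bounded_mono: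
  assumes "Hardy_term_bounded M M' N p p' q k A" and "k \<le> k'" "A \<le> A'" "0 \<le> q"
  shows "Hardy_term_bounded M M' N p p' q k' A'"
  unfolding Hardy_term_bounded_def
proof (intro ballI impI)
  fix f g assume fg: "f \<in> borel_measurable M" "g \<in> borel_measurable M'" "Lp_norm M p f < \<infinity>" "Lp_norm M' p' g < \<infinity>"
  have "Hardy_term M M' N q f g \<le> ennreal k * (Lp_norm M p f * Lp_norm M' p' g * A) epowr q"
    using assms(1) fg unfolding Hardy_term_bounded_def by blast
  also have "\<dots> \<le> ennreal k' * (Lp_norm M p f * Lp_norm M' p' g * A') epowr q"
    using assms by (intro mult_mono epowr_mono ennreal_leI) auto
  finally show "Hardy_term M M' N q f g \<le> ennreal k' * (Lp_norm M p f * Lp_norm M' p' g * A') epowr q" .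
qed

lemma Lp_norm_powr: "0 < p \<Longrightarrow> (\<integral>\<^sup>+t. f t epowr p \<partial>M) epowr (q / p) = Lp_norm M p f epowr q"
  by (simp add: Lp_norm_def)

lemma Lp_norm_finite_iff: "0 < p \<Longrightarrow> Lp_norm M p f < top \<longleftrightarrow> (\<integral>\<^sup>+t. f t epowr p \<partial>M) < top"
  unfolding Lp_norm_def
  by (cases "(\<integral>\<^sup>+t. f t epowr p \<partial>M)" rule: ennreal_zero_top_pos_cases) (auto simp: epowr_ennreal)

definition bilinear_Hardy ::
  "real measure \<Rightarrow> real measure \<Rightarrow> real measure \<Rightarrow> real \<Rightarrow> real \<Rightarrow> real \<Rightarrow> ennreal \<Rightarrow> bool" where
  "bilinear_Hardy M M' N p p' q C \<longleftrightarrow>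
     (\<forall>f\<in>borel_measurable M. \<forall>g\<in>borel_measurable M'.
        Lp_norm M p f < \<infinity> \<longrightarrow> Lp_norm M' p' g < \<infinity> \<longrightarrow>
        (\<integral>\<^sup>+x. (cumul M f x * cumul M' g x) epowr q \<partial>N) epowr (1 / q)
          \<le> C * Lp_norm M p f * Lp_norm M' p' g)"

lemma bilinear_Hardy_swap: "bilinear_Hardy M M' N p p' q C \<Longrightarrow> bilinear_Hardy M' M N p' p q C"
  unfolding bilinear_Hardy_def by (simp add: mult.commute mult.left_commute) 

context diffuse_measure
begin

lemma inner_weight_measurable [measurable]:
  assumes "diffuse_measure N" and [measurable]: "(\<lambda>x. x) \<in> borel_measurable L"
  shows "inner_weight N M q r \<in> borel_measurable L"
proof -
  interpret N: diffuse_measure N by fact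
  show ?thesis unfolding inner_weight_def by measurable
qed

lemma inner_weight_integrable:
  assumes "diffuse_measure N" and "0 \<le> r" "1 \<le> q"
  shows "(\<integral>\<^sup>+t. inner_weight N M q r t \<partial>M) < \<infinity>"
proof -
  interpret N: diffuse_measure N by fact
  have "(\<integral>\<^sup>+t. inner_weight N M q r t \<partial>M) 
     \<le> (\<integral>\<^sup>+t. emeasure N (space N) epowr (r / q) * emeasure M (space M) epowr (r * (1 - 1 / q)) \<partial>M)"
    unfolding inner_weight_def using assms cumul_le_integral[of M "\<lambda>_. 1"] tail_le_integral[of N "\<lambda>_. 1"]
    by (intro nn_integral_mono mult_mono epowr_mono) auto
  also have "\<dots> < \<infinity>"
    using assms by (simp add: ennreal_mult_less_top emeasure_eq_measure N.emeasure_eq_measure)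
  finally show ?thesis .
qed

lemma integrable_of_Lp:
  assumes [measurable]: "f \<in> borel_measurable M" and p: "1 < p" and fin: "Lp_norm M p f < \<infinity>"
  shows "(\<integral>\<^sup>+t. f t \<partial>M) < \<infinity>"
proof -
  have "(\<integral>\<^sup>+t. f t \<partial>M) = (\<integral>\<^sup>+t. (f t epowr p) epowr (1 / p) * 1 epowr (1 - 1 / p) \<partial>M)"
    using p by simp
  also have "\<dots> \<le> Lp_norm M p f * (\<integral>\<^sup>+t. 1 \<partial>M) epowr (1 - 1 / p)"
    unfolding Lp_norm_def using p by (intro Holder_nn_integral) auto
  also have "\<dots> < \<infinity>"
    using p fin by (simp add: ennreal_mult_less_top emeasure_eq_measure)
  finally show ?thesis .
qed

text \<open>
  The chain rule for \<open>F^q\<close> turns the linear Hardy inequality into the one-term estimate with the tail of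
  the weight.
\<close>

lemma Hardy_sufficiency_le:
  assumes N: "diffuse_measure N" and [measurable]: "f \<in> borel_measurable M" "w \<in> borel_measurable N"
    and p: "1 < p" "p \<le> q" and f: "Lp_norm M p f < \<infinity>"
    and S: "AE t in M. distribution_fun M t epowr (1 - 1 / p) * tail N w t epowr (1 / q) \<le> S"
  shows "(\<integral>\<^sup>+x. w x * cumul M f x epowr q \<partial>N) \<le> ennreal (q * hardy_const p) * (Lp_norm M p f * S) epowr q"
proof -
  interpret N: diffuse_measure N by fact
  have "(\<integral>\<^sup>+x. w x * cumul M f x epowr q \<partial>N)
       = ennreal q * (\<integral>\<^sup>+t. tail N w t * cumul M f t epowr (q - 1) * f t \<partial>M)"
    using p by (intro integral_cumul_powr N integrable_of_Lp[of f p] f) auto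
  also have "\<dots> \<le> ennreal q * (ennreal ((p / (p - 1)) powr p) * (\<integral>\<^sup>+t. f t epowr p \<partial>M) epowr (q / p) * S epowr q)"
  proof (intro mult_left_mono Hardy_term_bound_le p)
    show "AE t in M. tail N w t * distribution_fun M t epowr (q * (1 - 1 / p)) \<le> S epowr q"
      using S
    proof eventually_elim
      case (elim t)
      have "tail N w t * distribution_fun M t epowr (q * (1 - 1 / p))
          = (distribution_fun M t epowr (1 - 1 / p) * tail N w t epowr (1 / q)) epowr q"
        using p by (simp add: epowr_mult mult.commute)
      also have "\<dots> \<le> S epowr q" using p elim by (intro epowr_mono) auto
      finally show ?case .
    qed
  qed auto
  also have "\<dots> = ennreal (q * hardy_const p) * (Lp_norm M p f * S) epowr q"
    using p by (simp add: Lp_norm_powr epowr_mult hardy_const_def ennreal_mult ac_simps)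
  finally show ?thesis .
qed

lemma Hardy_sufficiency_gt:
  assumes N: "diffuse_measure N" and [measurable]: "f \<in> borel_measurable M" "w \<in> borel_measurable N"
    and q: "1 < q" "q < p" and f: "Lp_norm M p f < \<infinity>"
  defines "r \<equiv> r_exp q p"
  shows "(\<integral>\<^sup>+x. w x * cumul M f x epowr q \<partial>N) \<le> ennreal (q * hardy_const p) * (Lp_norm M p f *
     (\<integral>\<^sup>+t. tail N w t epowr (r / q) * distribution_fun M t epowr (r * (1 - 1 / q)) \<partial>M) epowr (1 / r)) epowr q"
proof -
  interpret N: diffuse_measure N by fact
  have r: "1 / r = 1 / q - 1 / p" "0 < r"
    using r_exp_pos[of q p] q by (simp_all add: r_def) (simp add: r_exp_def)
  have "(\<integral>\<^sup>+x. w x * cumul M f x epowr q \<partial>N)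
       = ennreal q * (\<integral>\<^sup>+t. tail N w t * cumul M f t epowr (q - 1) * f t \<partial>M)"
    using q by (intro integral_cumul_powr N integrable_of_Lp[of f p] f) auto
  also have "\<dots> \<le> ennreal q * (ennreal ((p / (p - 1)) powr p) * (\<integral>\<^sup>+t. f t epowr p \<partial>M) epowr (q / p) *
     (\<integral>\<^sup>+t. tail N w t epowr (r / q) * distribution_fun M t epowr (r * (1 - 1 / q)) \<partial>M) epowr (q / r))"
    by (intro mult_left_mono Hardy_term_bound_gt q r) auto
  also have "\<dots> = ennreal (q * hardy_const p) * (Lp_norm M p f *
     (\<integral>\<^sup>+t. tail N w t epowr (r / q) * distribution_fun M t epowr (r * (1 - 1 / q)) \<partial>M) epowr (1 / r)) epowr q"
    using q by (simp add: Lp_norm_powr epowr_mult hardy_const_def ennreal_mult ac_simps)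
  finally show ?thesis .
qed

lemma Hardy_term_le:
  assumes "diffuse_measure M'" "diffuse_measure N"
    and [measurable]: "f \<in> borel_measurable M" "g \<in> borel_measurable M'"
    and p: "1 < p" "p \<le> q" "1 < p'"
    and A: "AE t in M. tail N (\<lambda>_. 1) t epowr (1 / q) * distribution_fun M t epowr (1 - 1 / p)
              * distribution_fun M' t epowr (1 - 1 / p') \<le> A"
  shows "Hardy_term M M' N q f g \<le> ennreal (hardy_const p) * (Lp_norm M p f * Lp_norm M' p' g * A) epowr q"
proof -
  interpret M': diffuse_measure M' by fact
  interpret N: diffuse_measure N by fact
  have "Hardy_term M M' N q f g \<le> ennreal ((p / (p - 1)) powr p) * (\<integral>\<^sup>+t. f t epowr p \<partial>M) epowr (q / p)
          * (Lp_norm M' p' g * A) epowr q"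
    unfolding Hardy_term_def
  proof (intro Hardy_term_bound_le p)
    show "AE t in M. tail N (\<lambda>_. 1) t * cumul M' g t epowr q * distribution_fun M t epowr (q * (1 - 1 / p))
        \<le> (Lp_norm M' p' g * A) epowr q"
      using A
    proof eventually_elim
      case (elim t)
      have "tail N (\<lambda>_. 1) t * cumul M' g t epowr q * distribution_fun M t epowr (q * (1 - 1 / p))
          = (tail N (\<lambda>_. 1) t epowr (1 / q) * cumul M' g t * distribution_fun M t epowr (1 - 1 / p)) epowr q"
        using p by (simp add: epowr_mult mult.commute[of "1 - 1 / p" q])
      also have "\<dots> \<le> (tail N (\<lambda>_. 1) t epowr (1 / q) * (Lp_norm M' p' g * distribution_fun M' t epowr (1 - 1 / p'))
           * distribution_fun M t epowr (1 - 1 / p)) epowr q"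
        unfolding Lp_norm_def using p
        by (intro epowr_mono mult_left_mono mult_right_mono M'.cumul_le_norm) auto
      also have "\<dots> = (Lp_norm M' p' g * (tail N (\<lambda>_. 1) t epowr (1 / q) * distribution_fun M t epowr (1 - 1 / p)
              * distribution_fun M' t epowr (1 - 1 / p'))) epowr q"
        by (simp add: ac_simps)
      also have "\<dots> \<le> (Lp_norm M' p' g * A) epowr q"
        using p elim by (intro epowr_mono mult_left_mono) auto
      finally show ?case .
    qed
  qed auto
  also have "\<dots> = ennreal (hardy_const p) * (Lp_norm M p f * Lp_norm M' p' g * A) epowr q"
    using p by (simp add: Lp_norm_powr epowr_mult hardy_const_def ac_simps)
  finally show ?thesis .
qed

text \<open>
  The one-term estimate bounds the term by an integral of \<open>G^r\<close> against the inner weight, so that a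
  linear Hardy inequality for \<open>G\<close> with exponent \<open>r\<close>, which is the last hypothesis, suffices.
\<close>

lemma Hardy_term_gt:
  assumes "diffuse_measure M'" "diffuse_measure N"
    and [measurable]: "f \<in> borel_measurable M" "g \<in> borel_measurable M'"
    and q: "1 < q" "q < p" and k: "0 \<le> k"
  defines "r \<equiv> r_exp q p"
  assumes B: "(\<integral>\<^sup>+t. inner_weight N M q r t * cumul M' g t epowr r \<partial>M) \<le> ennreal k * (Lp_norm M' p' g * A) epowr r"
  shows "Hardy_term M M' N q f g
    \<le> ennreal (hardy_const p * k powr (q / r)) * (Lp_norm M p f * Lp_norm M' p' g * A) epowr q"
proof -
  interpret M': diffuse_measure M' by fact
  interpret N: diffuse_measure N by fact
  have r: "1 / r = 1 / q - 1 / p" "0 < r"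
    using r_exp_pos[of q p] q by (simp_all add: r_def) (simp add: r_exp_def)
  have "Hardy_term M M' N q f g \<le> ennreal ((p / (p - 1)) powr p) * (\<integral>\<^sup>+t. f t epowr p \<partial>M) epowr (q / p) *
     (\<integral>\<^sup>+t. (tail N (\<lambda>_. 1) t * cumul M' g t epowr q) epowr (r / q) * distribution_fun M t epowr (r * (1 - 1 / q)) \<partial>M) epowr (q / r)"
    unfolding Hardy_term_def by (intro Hardy_term_bound_gt q r) auto
  also have "(\<integral>\<^sup>+t. (tail N (\<lambda>_. 1) t * cumul M' g t epowr q) epowr (r / q) * distribution_fun M t epowr (r * (1 - 1 / q)) \<partial>M)
      = (\<integral>\<^sup>+t. inner_weight N M q r t * cumul M' g t epowr r \<partial>M)"
    using q r by (intro nn_integral_cong) (simp add: epowr_mult inner_weight_def ac_simps)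
  also have "ennreal ((p / (p - 1)) powr p) * (\<integral>\<^sup>+t. f t epowr p \<partial>M) epowr (q / p) * \<dots> epowr (q / r)
     \<le> ennreal ((p / (p - 1)) powr p) * (\<integral>\<^sup>+t. f t epowr p \<partial>M) epowr (q / p) *
       (ennreal k * (Lp_norm M' p' g * A) epowr r) epowr (q / r)"
    using q r B by (intro mult_left_mono epowr_mono) auto
  also have "(ennreal k * (Lp_norm M' p' g * A) epowr r) epowr (q / r)
      = ennreal (k powr (q / r)) * (Lp_norm M' p' g * A) epowr q"
    using q r k by (cases "k = 0") (simp_all add: epowr_mult epowr_ennreal)
  finally show ?thesis
    using q by (simp add: Lp_norm_powr epowr_mult hardy_const_def ennreal_mult ac_simps)
qed

lemma bilinear_Hardy_of_terms:
  assumes M': "diffuse_measure M'" and N: "diffuse_measure N"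
    and p: "1 < p" "1 < p'" "1 < q" and k: "0 \<le> k" "0 \<le> k'"
    and T: "Hardy_term_bounded M M' N p p' q k A"
    and T': "Hardy_term_bounded M' M N p' p q k' A"
  shows "bilinear_Hardy M M' N p p' q (ennreal ((q * (k + k')) powr (1 / q)) * A)"
  unfolding bilinear_Hardy_def
proof (intro ballI impI)
  interpret M': diffuse_measure M' by fact
  fix f g assume meas: "f \<in> borel_measurable M" "g \<in> borel_measurable M'"
    and fin: "Lp_norm M p f < \<infinity>" "Lp_norm M' p' g < \<infinity>"
  define X where "X = Lp_norm M p f * Lp_norm M' p' g * A"
  have "(\<integral>\<^sup>+x. (cumul M f x * cumul M' g x) epowr q \<partial>N)
      \<le> ennreal q * Hardy_term M M' N q f g + ennreal q * Hardy_term M' M N q g f"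
    unfolding Hardy_term_def
    using p by (intro integral_product_powr_le M' N meas integrable_of_Lp[of f p] M'.integrable_of_Lp[of g p'] fin) auto
  also have "\<dots> \<le> ennreal q * (ennreal k * X epowr q) + ennreal q * (ennreal k' * X epowr q)"
    using T[unfolded Hardy_term_bounded_def, rule_format, OF meas fin]
      T'[unfolded Hardy_term_bounded_def, rule_format, OF meas(2,1) fin(2,1)]
    by (intro add_mono mult_left_mono) (auto simp: X_def ac_simps)
  also have "\<dots> = ennreal (q * (k + k')) * X epowr q"
    using p k by (simp add: ennreal_mult distrib_left distrib_right ac_simps)
  finally have "(\<integral>\<^sup>+x. (cumul M f x * cumul M' g x) epowr q \<partial>N) epowr (1 / q)
      \<le> (ennreal (q * (k + k')) * X epowr q) epowr (1 / q)"
    using p by (intro epowr_mono) auto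
  also have "\<dots> = ennreal ((q * (k + k')) powr (1 / q)) * X"
    using p k by (cases "k + k' = 0") (simp_all add: epowr_mult epowr_ennreal zero_less_mult_iff)
  finally show "(\<integral>\<^sup>+x. (cumul M f x * cumul M' g x) epowr q \<partial>N) epowr (1 / q)
      \<le> ennreal ((q * (k + k')) powr (1 / q)) * A * Lp_norm M p f * Lp_norm M' p' g"
    by (simp add: X_def ac_simps)
qed

end

section \<open>Lower bounds for the bilinear Hardy constant\<close>

text \<open>
  The base is the constant in the lower bound for \<open>\<integral>G^q dN\<close> by the \<open>p\<close>-th power of the norm of the test
  function. The quotient \<open>r(1 - 1/p)/q\<close> is the exponent of \<open>V\<close> in the primitive of that function.
\<close>

definition test_const :: "real \<Rightarrow> real \<Rightarrow> real" where
  "test_const q p = ((r_exp q p * (1 - 1 / p) / q) powr (- q) * (q * (1 - 1 / p))) powr (1 / q)"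

lemma test_const_pos: "1 < q \<Longrightarrow> q < p \<Longrightarrow> 0 < test_const q p"
  using r_exp_pos[of q p] by (simp add: test_const_def)

context diffuse_measure
begin

text \<open>
  The test function is \<open>h = T^(r/(pq)) V^(r/(pq'))\<close> with \<open>T\<close> the tail of \<open>N\<close>; its \<open>p\<close>-th power is the
  integrand of \<open>B\<close>. As \<open>T\<close> decreases, the running integral of \<open>h\<close> at \<open>x\<close> is at least \<open>T(x)^(r/(pq))\<close>
  times that of the power of \<open>V\<close>, so its \<open>q\<close>-th power is at least a constant times
  \<open>T^(r/p) V^(r/p')\<close>. Integrating this against \<open>N\<close> by parts gives \<open>B\<close> again.
\<close>

lemma Hardy_test_function:
  assumes N: "diffuse_measure N" and q: "1 < q" "q < p"
  defines "r \<equiv> r_exp q p"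
  defines "B \<equiv> (\<integral>\<^sup>+t. tail N (\<lambda>_. 1) t epowr (r / q) * distribution_fun M t epowr (r * (1 - 1 / q)) \<partial>M)"
  shows "\<exists>h \<in> borel_measurable M. (\<integral>\<^sup>+t. h t epowr p \<partial>M) = B \<and> B < \<infinity> \<and>
     ennreal (test_const q p) * B epowr (1 / r) * B epowr (1 / p) \<le> (\<integral>\<^sup>+x. cumul M h x epowr q \<partial>N) epowr (1 / q)"
proof -
  interpret N: diffuse_measure N by fact
  have p: "1 < p" using q by simp
  have rinv: "1 / r = 1 / q - 1 / p" by (simp add: r_def r_exp_def)
  have "0 < 1 / r" unfolding rinv using q by (simp add: field_simps)
  then have r0: "0 < r" by simp
  have r1: "r / q = r / p + 1" using rinv r0 p q by (simp add: field_simps)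
  define b where "b = 1 - 1 / p"
  have b: "0 < b" using p by (simp add: b_def)
  define a where "a = r * b / q"
  have a: "0 < a" using r0 b q by (simp add: a_def)
  have a1: "a - 1 = r * (1 - 1 / q) / p"
    using r1 p q by (simp add: a_def b_def field_simps)
  have rb: "r * b - 1 = r * (1 - 1 / q)"
    using r1 by (simp add: b_def algebra_simps)
  define V where "V = distribution_fun M"
  define T where "T = tail N (\<lambda>_. 1)"
  have meas: "V \<in> borel_measurable L" "T \<in> borel_measurable L" if "(\<lambda>x. x) \<in> borel_measurable L" for L
    using that unfolding V_def T_def by measurable
  note [measurable] = meas[OF ident_measurable] meas[OF N.ident_measurable]
  have fin1: "(\<integral>\<^sup>+t. 1 \<partial>M) < \<infinity>" "(\<integral>\<^sup>+t. 1 \<partial>N) < \<infinity>"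
    by (auto simp: emeasure_eq_measure N.emeasure_eq_measure)
  define h where "h = (\<lambda>t. T t epowr (r / (q * p)) * V t epowr (a - 1))"
  have [measurable]: "h \<in> borel_measurable M" unfolding h_def by measurable
  have hB: "(\<integral>\<^sup>+t. h t epowr p \<partial>M) = B"
    unfolding B_def h_def T_def[symmetric] V_def[symmetric] using p q a1
    by (intro nn_integral_cong) (simp add: epowr_mult)
  have Bfin: "B < \<infinity>"
    using inner_weight_integrable[OF N, of r q] r0 q by (simp add: B_def inner_weight_def)
  have h_ge: "T x epowr (r / p) * (ennreal (a powr - q) * V x epowr (r * b)) \<le> cumul M h x epowr q" for x
  proof -
    have "V x epowr a = ennreal a * cumul M (\<lambda>t. V t epowr (a - 1)) x"
      using cumul_powr[of "\<lambda>_. 1" a x] a fin1 by (simp add: V_def)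
    then have "cumul M (\<lambda>t. V t epowr (a - 1)) x = ennreal (1 / a) * V x epowr a"
      using a by (simp add: mult.assoc[symmetric] flip: ennreal_mult)
    then have "T x epowr (r / (q * p)) * (ennreal (1 / a) * V x epowr a)
        = cumul M (\<lambda>t. T x epowr (r / (q * p)) * V t epowr (a - 1)) x"
      by (subst cumul_cmult) auto
    also have "\<dots> \<le> cumul M h x"
      unfolding cumul_def h_def T_def using r0 p q
      by (intro nn_integral_mono) (auto simp: indicator_def intro!: mult_right_mono epowr_mono tail_antimono)
    finally have "(T x epowr (r / (q * p)) * (ennreal (1 / a) * V x epowr a)) epowr q \<le> cumul M h x epowr q"
      using q by (intro epowr_mono) auto
    moreover have "(1 / a) powr q = a powr - q"
      using a by (simp add: powr_minus powr_divide inverse_eq_divide)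
    moreover have "a * q = r * b" using q by (simp add: a_def)
    ultimately show ?thesis
      using q a by (simp add: epowr_mult epowr_ennreal)
  qed
  \<comment> \<open>The following chain is the integration by parts: the chain rule for \<open>T\<close> gives the factor \<open>q/r\<close>,
    the exchange of order moves the tail over to a running integral, and the chain rule for \<open>V\<close>
    gives the factor \<open>r b\<close>.\<close>
  have "ennreal (a powr - q * (q * b)) * B = ennreal (a powr - q) * (ennreal (r * b) * (ennreal (q / r) * B))"
    using q r0 b by (simp add: mult.assoc[symmetric] flip: ennreal_mult) (simp add: ac_simps)
  also have "ennreal (q / r) * B = (\<integral>\<^sup>+t. V t epowr (r * b - 1) * tail N (\<lambda>x. T x epowr (r / p)) t \<partial>M)"
  proof -
    have *: "ennreal (q / r) * T t epowr (r / q) = tail N (\<lambda>x. T x epowr (r / p)) t" for t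
    proof -
      have "T t epowr (r / q) = ennreal (r / q) * tail N (\<lambda>x. T x epowr (r / p)) t"
      proof -
        have "r / p = r / q - 1" using r1 by simp
        then show ?thesis
          using N.tail_powr[of "\<lambda>_. 1" "r / q" t] r0 q fin1 by (simp only: T_def) simp
      qed
      then show ?thesis
        using r0 q by (simp add: mult.assoc[symmetric] flip: ennreal_mult)
    qed
    have "ennreal (q / r) * B = (\<integral>\<^sup>+t. ennreal (q / r) * (T t epowr (r / q) * V t epowr (r * (1 - 1 / q))) \<partial>M)"
      unfolding B_def T_def V_def by (rule nn_integral_cmult[symmetric]) measurable
    also have "\<dots> = (\<integral>\<^sup>+t. V t epowr (r * b - 1) * tail N (\<lambda>x. T x epowr (r / p)) t \<partial>M)"
      unfolding rb *[symmetric] by (simp add: ac_simps)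
    finally show ?thesis .
  qed
  also have "\<dots> = (\<integral>\<^sup>+x. T x epowr (r / p) * cumul M (\<lambda>t. V t epowr (r * b - 1)) x \<partial>N)"
    by (rule integral_cumul_eq_integral_tail[OF N, symmetric]) measurable
  also have "ennreal (r * b) * \<dots> = (\<integral>\<^sup>+x. T x epowr (r / p) * V x epowr (r * b) \<partial>N)"
  proof -
    have "V x epowr (r * b) = ennreal (r * b) * cumul M (\<lambda>t. V t epowr (r * b - 1)) x" for x
      using cumul_powr[of "\<lambda>_. 1" "r * b" x] r0 b fin1 by (simp add: V_def)
    then show ?thesis
      by (subst nn_integral_cmult[symmetric]) (auto intro!: nn_integral_cong simp: ac_simps)
  qed
  also have "ennreal (a powr - q) * \<dots> = (\<integral>\<^sup>+x. T x epowr (r / p) * (ennreal (a powr - q) * V x epowr (r * b)) \<partial>N)"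
    by (subst nn_integral_cmult[symmetric]) (auto intro!: nn_integral_cong simp: ac_simps)
  also have "\<dots> \<le> (\<integral>\<^sup>+x. cumul M h x epowr q \<partial>N)"
    by (intro nn_integral_mono h_ge)
  finally have "(ennreal (a powr - q * (q * b)) * B) epowr (1 / q) \<le> (\<integral>\<^sup>+x. cumul M h x epowr q \<partial>N) epowr (1 / q)"
    using q by (intro epowr_mono) auto
  also have "(ennreal (a powr - q * (q * b)) * B) epowr (1 / q) = ennreal (test_const q p) * B epowr (1 / r + 1 / p)"
  proof -
    have "0 < a powr - q * (q * b)" using a q b by simp
    moreover have "1 / r + 1 / p = 1 / q" using rinv by simp
    ultimately show ?thesis
      using q by (simp add: epowr_mult epowr_ennreal test_const_def a_def b_def r_def)
  qed
  also have "B epowr (1 / r + 1 / p) = B epowr (1 / r) * B epowr (1 / p)"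
    using r0 p by (intro epowr_add) auto
  finally show ?thesis
    using hB Bfin by (intro bexI[of _ h]) (auto simp: mult.assoc)
qed

text \<open>
  The quantity \<open>B\<close> of the test function is finite, so the norm \<open>B^(1/p)\<close> of the test function cancels.
\<close>

lemma Hardy_necessity:
  assumes N: "diffuse_measure N" and q: "1 < q" "q < p"
  defines "r \<equiv> r_exp q p"
  assumes D: "\<And>h. h \<in> borel_measurable M \<Longrightarrow> (\<integral>\<^sup>+t. h t epowr p \<partial>M) < \<infinity> \<Longrightarrow>
     (\<integral>\<^sup>+x. cumul M h x epowr q \<partial>N) epowr (1 / q) \<le> D * (\<integral>\<^sup>+t. h t epowr p \<partial>M) epowr (1 / p)"
  shows "ennreal (test_const q p) *
     (\<integral>\<^sup>+t. tail N (\<lambda>_. 1) t epowr (r / q) * distribution_fun M t epowr (r * (1 - 1 / q)) \<partial>M) epowr (1 / r) \<le> D"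
proof -
  define B where "B = (\<integral>\<^sup>+t. tail N (\<lambda>_. 1) t epowr (r / q) * distribution_fun M t epowr (r * (1 - 1 / q)) \<partial>M)"
  have "1 / r = 1 / q - 1 / p" by (simp add: r_def r_exp_def)
  also have "\<dots> > 0" using q by (simp add: field_simps)
  finally have r0: "0 < r" by simp
  obtain h where h: "h \<in> borel_measurable M" "(\<integral>\<^sup>+t. h t epowr p \<partial>M) = B" "B < \<infinity>"
    "ennreal (test_const q p) * B epowr (1 / r) * B epowr (1 / p) \<le> (\<integral>\<^sup>+x. cumul M h x epowr q \<partial>N) epowr (1 / q)"
    using Hardy_test_function[OF N q] unfolding B_def r_def by blast
  have le: "B epowr (1 / p) * (ennreal (test_const q p) * B epowr (1 / r)) \<le> B epowr (1 / p) * D"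
    using order_trans[OF h(4) D[OF h(1)]] h by (simp add: mult.commute)
  show ?thesis
  proof (cases "B = 0")
    case True
    then show ?thesis using r0 by (simp add: B_def)
  next
    case False
    then have "0 < B epowr (1 / p)" "B epowr (1 / p) < top"
      using epowr_pos_fin[of B "1 / p"] h(3) by (auto simp: zero_less_iff_neq_zero)
    then show ?thesis
      using le unfolding B_def[symmetric] by (subst (asm) ennreal_mult_le_mult_iff) auto
  qed
qed

lemma cumul_indicator:
  "cumul M (indicator {..x}) y = distribution_fun M (min x y)"
  unfolding cumul_def by (intro nn_integral_cong) (auto simp: indicator_def)

lemma Lp_norm_indicator: "0 < p \<Longrightarrow> Lp_norm M p (indicator {..x}) = distribution_fun M x epowr (1 / p)"
  unfolding Lp_norm_def cumul_def
  by (intro arg_cong2[where f = "(epowr)"] nn_integral_cong) (auto simp: indicator_def)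

lemma distribution_fun_split:
  "1 < p \<Longrightarrow> distribution_fun M x = distribution_fun M x epowr (1 / p) * distribution_fun M x epowr (1 - 1 / p)"
  by (simp flip: epowr_add)

lemma bilinear_Hardy_ge_A1:
  assumes M': "diffuse_measure M'" and N: "diffuse_measure N"
    and p: "1 < p" "1 < p'" "1 < q"
    and C: "bilinear_Hardy M M' N p p' q C"
  shows "tail N (\<lambda>_. 1) x epowr (1 / q) * distribution_fun M x epowr (1 - 1 / p)
              * distribution_fun M' x epowr (1 - 1 / p') \<le> C"
proof -
  interpret M': diffuse_measure M' by fact
  interpret N: diffuse_measure N by fact
  define v where "v = distribution_fun M x"
  define v' where "v' = distribution_fun M' x"
  define U where "U = tail N (\<lambda>_. 1) x"
  have [measurable]: "indicator {..x} \<in> borel_measurable M" "indicator {..x} \<in> borel_measurable M'"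
    by measurable
  have fin: "v < top" "v' < top" by (simp_all add: v_def v'_def)
  have norms: "Lp_norm M p (indicator {..x}) = v epowr (1 / p)" "Lp_norm M' p' (indicator {..x}) = v' epowr (1 / p')"
    using p by (simp_all add: Lp_norm_indicator M'.Lp_norm_indicator v_def v'_def)
  have "(v * v') epowr q * U = (\<integral>\<^sup>+y. (v * v') epowr q * indicator {x..} y \<partial>N)"
    by (simp add: U_def tail_def nn_integral_cmult)
  also have "\<dots> \<le> (\<integral>\<^sup>+y. (cumul M (indicator {..x}) y * cumul M' (indicator {..x}) y) epowr q \<partial>N)"
    by (intro nn_integral_mono)
       (auto simp: indicator_def cumul_indicator M'.cumul_indicator v_def v'_def min_def)
  finally have "((v * v') epowr q * U) epowr (1 / q)
      \<le> (\<integral>\<^sup>+y. (cumul M (indicator {..x}) y * cumul M' (indicator {..x}) y) epowr q \<partial>N) epowr (1 / q)"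
    using p by (intro epowr_mono) auto
  also have "\<dots> \<le> C * v epowr (1 / p) * v' epowr (1 / p')"
    using C[unfolded bilinear_Hardy_def, rule_format, of "indicator {..x}" "indicator {..x}"] p fin
    by (simp add: norms)
  also have "((v * v') epowr q * U) epowr (1 / q) = v * v' * U epowr (1 / q)"
    using p by (simp add: epowr_mult)
  also have "v * v' * U epowr (1 / q) = (v epowr (1 / p) * v' epowr (1 / p'))
       * (U epowr (1 / q) * v epowr (1 - 1 / p) * v' epowr (1 - 1 / p'))"
    using distribution_fun_split[of p x] M'.distribution_fun_split[of p' x] p
    unfolding v_def[symmetric] v'_def[symmetric] by (simp add: ac_simps flip: v_def v'_def)
  finally have le: "(v epowr (1 / p) * v' epowr (1 / p')) * (U epowr (1 / q) * v epowr (1 - 1 / p) * v' epowr (1 - 1 / p'))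
      \<le> (v epowr (1 / p) * v' epowr (1 / p')) * C"
    by (simp add: ac_simps)
  show ?thesis
  proof (cases "v = 0 \<or> v' = 0")
    case True
    then show ?thesis using p by (auto simp: v_def v'_def)
  next
    case False
    then have "0 < v epowr (1 / p) * v' epowr (1 / p')" "v epowr (1 / p) * v' epowr (1 / p') < top"
      using epowr_pos_fin[of v "1 / p"] epowr_pos_fin[of v' "1 / p'"] fin
      by (auto simp: zero_less_iff_neq_zero ennreal_mult_less_top)
    then show ?thesis
      using le unfolding v_def[symmetric] v'_def[symmetric] U_def[symmetric]
      by (subst (asm) ennreal_mult_le_mult_iff) auto
  qed
qed

text \<open>
  For fixed \<open>f\<close> the bilinear inequality is a linear one for \<open>g\<close> and the measure \<open>F^q dN\<close>, whose
  constant is at least the quantity of \<open>Hardy_necessity\<close>. The tail of \<open>F^q dN\<close> at \<open>t\<close> is at least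
  \<open>F(t)^q\<close> times the tail of \<open>N\<close>, because \<open>F\<close> increases. What results is a linear inequality for \<open>f\<close>.
\<close>

lemma bilinear_Hardy_partial_necessity:
  assumes M': "diffuse_measure M'" and N: "diffuse_measure N"
    and p: "1 < p" "1 < q" "q < p'"
    and C: "bilinear_Hardy M M' N p p' q C"
    and [measurable]: "f \<in> borel_measurable M" and fin: "Lp_norm M p f < \<infinity>"
  defines "r \<equiv> r_exp q p'"
  shows "ennreal (test_const q p') * (\<integral>\<^sup>+t. inner_weight N M' q r t * cumul M f t epowr r \<partial>M') epowr (1 / r)
      \<le> C * Lp_norm M p f"
proof -
  interpret M': diffuse_measure M' by fact
  interpret N: diffuse_measure N by fact
  have r0: "0 < r" using r_exp_pos[of q p'] p by (simp add: r_def)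
  define F where "F = cumul M f"
  have [measurable]: "F \<in> borel_measurable N" "F \<in> borel_measurable M'" unfolding F_def by measurable
  define N' where "N' = density N (\<lambda>x. F x epowr q)"
  have Ffin: "(\<integral>\<^sup>+t. f t \<partial>M) < \<infinity>"
    using p fin by (intro integrable_of_Lp[of f p]) auto
  have "(\<integral>\<^sup>+x. F x epowr q \<partial>N) \<le> (\<integral>\<^sup>+x. (\<integral>\<^sup>+t. f t \<partial>M) epowr q \<partial>N)"
    unfolding F_def using p by (intro nn_integral_mono epowr_mono cumul_le_integral) auto
  also have "\<dots> < \<infinity>"
    using p Ffin by (simp add: ennreal_mult_less_top N.emeasure_eq_measure)
  finally have N': "diffuse_measure N'"
    unfolding N'_def by (intro N.density_diffuse) auto
  have "ennreal (test_const q p') *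
     (\<integral>\<^sup>+t. tail N' (\<lambda>_. 1) t epowr (r / q) * distribution_fun M' t epowr (r * (1 - 1 / q)) \<partial>M') epowr (1 / r)
     \<le> C * Lp_norm M p f"
    unfolding r_def
  proof (rule M'.Hardy_necessity[OF N'])
    fix h assume h[measurable]: "h \<in> borel_measurable M'" and hfin: "(\<integral>\<^sup>+t. h t epowr p' \<partial>M') < \<infinity>"
    have "(\<integral>\<^sup>+x. cumul M' h x epowr q \<partial>N') = (\<integral>\<^sup>+x. (cumul M f x * cumul M' h x) epowr q \<partial>N)"
      unfolding N'_def using p by (subst nn_integral_density) (auto simp: epowr_mult F_def)
    then show "(\<integral>\<^sup>+x. cumul M' h x epowr q \<partial>N') epowr (1 / q)
        \<le> C * Lp_norm M p f * (\<integral>\<^sup>+t. h t epowr p' \<partial>M') epowr (1 / p')"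
      using C fin h hfin p Lp_norm_finite_iff[of p' M' h] unfolding bilinear_Hardy_def 
      by (simp add: Lp_norm_def)
  qed (use p in auto)
  moreover have "(\<integral>\<^sup>+t. inner_weight N M' q r t * F t epowr r \<partial>M')
     \<le> (\<integral>\<^sup>+t. tail N' (\<lambda>_. 1) t epowr (r / q) * distribution_fun M' t epowr (r * (1 - 1 / q)) \<partial>M')"
  proof (rule nn_integral_mono)
    fix t
    have "F t epowr q * tail N (\<lambda>_. 1) t \<le> tail N' (\<lambda>_. 1) t"
    proof -
      have "F t epowr q * tail N (\<lambda>_. 1) t = (\<integral>\<^sup>+x. F t epowr q * indicator {t..} x \<partial>N)"
        by (simp add: tail_def nn_integral_cmult)
      also have "\<dots> \<le> tail N (\<lambda>x. F x epowr q) t"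
        unfolding tail_def F_def using p
        by (intro nn_integral_mono) (auto simp: indicator_def intro!: epowr_mono cumul_mono)
      also have "\<dots> = tail N' (\<lambda>_. 1) t"
        unfolding N'_def by (subst tail_density) auto
      finally show ?thesis .
    qed
    then have "(F t epowr q * tail N (\<lambda>_. 1) t) epowr (r / q) \<le> tail N' (\<lambda>_. 1) t epowr (r / q)"
      using p r0 by (intro epowr_mono) auto
    then have "F t epowr r * tail N (\<lambda>_. 1) t epowr (r / q) \<le> tail N' (\<lambda>_. 1) t epowr (r / q)"
      using p r0 by (simp add: epowr_mult)
    then show "inner_weight N M' q r t * F t epowr r
      \<le> tail N' (\<lambda>_. 1) t epowr (r / q) * distribution_fun M' t epowr (r * (1 - 1 / q))"
      unfolding inner_weight_def by (metis (no_types, lifting) mult.assoc mult.commute mult_right_mono zero_le)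
  qed
  ultimately show ?thesis
    using r0 unfolding F_def by (elim order_trans[rotated]) (intro mult_left_mono epowr_mono, auto)
qed

text \<open>
  Take the indicator of \<open>(-\<infinity>, x]\<close> for \<open>f\<close> in \<open>bilinear_Hardy_partial_necessity\<close>: from \<open>x\<close> on, its
  running integral is constant.
\<close>

lemma bilinear_Hardy_ge_A2:
  assumes M': "diffuse_measure M'" and N: "diffuse_measure N"
    and p: "1 < p" "1 < q" "q < p'"
    and C: "bilinear_Hardy M M' N p p' q C"
  defines "r \<equiv> r_exp q p'"
  shows "ennreal (test_const q p') * (distribution_fun M x epowr (1 - 1 / p)
      * tail M' (inner_weight N M' q r) x epowr (1 / r)) \<le> C"
proof -
  interpret M': diffuse_measure M' by fact
  interpret N: diffuse_measure N by fact
  have r0: "0 < r" using r_exp_pos[of q p'] p by (simp add: r_def)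
  define v where "v = distribution_fun M x"
  define E where "E = tail M' (inner_weight N M' q r) x"
  have fin: "v < top" by (simp add: v_def)
  have norm: "Lp_norm M p (indicator {..x}) = v epowr (1 / p)"
    using p by (simp add: Lp_norm_indicator v_def)
  have [measurable]: "indicator {..x} \<in> borel_measurable M" by measurable
  have [measurable]: "inner_weight N M' q r \<in> borel_measurable M'"
    using N by (intro M'.inner_weight_measurable) auto
  have "v epowr r * E = (\<integral>\<^sup>+t. v epowr r * (inner_weight N M' q r t * indicator {x..} t) \<partial>M')"
    unfolding E_def tail_def by (rule nn_integral_cmult[symmetric]) measurable
  also have "\<dots> \<le> (\<integral>\<^sup>+t. inner_weight N M' q r t * cumul M (indicator {..x}) t epowr r \<partial>M')"
    by (intro nn_integral_mono) (auto simp: indicator_def cumul_indicator v_def min_def mult.commute)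
  finally have "(v epowr r * E) epowr (1 / r) \<le> \<dots> epowr (1 / r)"
    using r0 by (intro epowr_mono) auto
  then have "ennreal (test_const q p') * (v epowr r * E) epowr (1 / r) \<le> ennreal (test_const q p') * \<dots>"
    by (intro mult_left_mono) auto
  also have "\<dots> \<le> C * v epowr (1 / p)"
    unfolding norm[symmetric] r_def
    using p fin by (intro bilinear_Hardy_partial_necessity M' N C) (auto simp: norm)
  also have "(v epowr r * E) epowr (1 / r) = v * E epowr (1 / r)"
    using r0 by (simp add: epowr_mult)
  also have "v * E epowr (1 / r) = v epowr (1 / p) * (v epowr (1 - 1 / p) * E epowr (1 / r))"
    using distribution_fun_split[of p x] p unfolding v_def by (metis (no_types, lifting) mult.assoc)
  finally have le: "v epowr (1 / p) * (ennreal (test_const q p') * (v epowr (1 - 1 / p) * E epowr (1 / r)))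
     \<le> v epowr (1 / p) * C"
    by (simp add: ac_simps)
  show ?thesis
  proof (cases "v = 0")
    case True
    then show ?thesis using p by (auto simp: v_def)
  next
    case False
    then have "0 < v epowr (1 / p)" "v epowr (1 / p) < top"
      using epowr_pos_fin[of v "1 / p"] fin by (auto simp: zero_less_iff_neq_zero)
    then show ?thesis
      using le unfolding v_def[symmetric] E_def[symmetric]
      by (subst (asm) ennreal_mult_le_mult_iff) auto
  qed
qed

text \<open>
  For \<open>r < p\<close> the linear inequality of \<open>bilinear_Hardy_partial_necessity\<close>, an inequality from \<open>L^p\<close>
  to \<open>L^r\<close>, is itself in the range of \<open>Hardy_necessity\<close>.
\<close>

lemma bilinear_Hardy_ge_A6:
  assumes M': "diffuse_measure M'" and N: "diffuse_measure N"
    and p: "1 < p" "1 < q" "q < p'"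
  defines "r \<equiv> r_exp q p'"
  assumes rp: "r < p"
    and C: "bilinear_Hardy M M' N p p' q C"
  defines "\<kappa> \<equiv> r_exp r p"
  shows "ennreal (test_const q p' * test_const r p) *
      (\<integral>\<^sup>+t. tail M' (inner_weight N M' q r) t epowr (\<kappa> / r) * distribution_fun M t epowr (\<kappa> * (1 - 1 / r)) \<partial>M) epowr (1 / \<kappa>)
      \<le> C"
proof -
  interpret M': diffuse_measure M' by fact
  interpret N: diffuse_measure N by fact
  have r0: "0 < r" "1 < r" using r_exp_pos[of q p'] r_exp_gt[of q p'] p by (simp_all add: r_def)
  have t: "0 < test_const q p'" using p by (intro test_const_pos) auto
  have [measurable]: "inner_weight N M' q r \<in> borel_measurable M'"
    using N by (intro M'.inner_weight_measurable) auto
  define E where "E = density M' (inner_weight N M' q r)"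
  have E: "diffuse_measure E"
    unfolding E_def using r0 p by (intro M'.density_diffuse M'.inner_weight_integrable N) auto
  have tailE: "tail E (\<lambda>_. 1) x = tail M' (inner_weight N M' q r) x" for x
    unfolding E_def by (subst tail_density) auto
  define X where "X = (\<integral>\<^sup>+t. tail M' (inner_weight N M' q r) t epowr (\<kappa> / r) * distribution_fun M t epowr (\<kappa> * (1 - 1 / r)) \<partial>M) epowr (1 / \<kappa>)"
  have "ennreal (test_const r p) * X \<le> ennreal (1 / test_const q p') * C"
    unfolding X_def tailE[symmetric] \<kappa>_def
  proof (rule Hardy_necessity[OF E \<open>1 < r\<close> rp])
    fix h assume h[measurable]: "h \<in> borel_measurable M" and hfin: "(\<integral>\<^sup>+t. h t epowr p \<partial>M) < \<infinity>"
    have "ennreal (test_const q p') * (\<integral>\<^sup>+x. cumul M h x epowr r \<partial>E) epowr (1 / r) \<le> C * Lp_norm M p h"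
    proof -
      have "(\<integral>\<^sup>+x. cumul M h x epowr r \<partial>E) = (\<integral>\<^sup>+x. inner_weight N M' q r x * cumul M h x epowr r \<partial>M')"
        unfolding E_def by (subst nn_integral_density) auto
      then show ?thesis
        using bilinear_Hardy_partial_necessity[OF M' N p C h] p hfin Lp_norm_finite_iff[of p M h]
        by (simp add: r_def)
    qed
    then have "ennreal (1 / test_const q p') * (ennreal (test_const q p') * (\<integral>\<^sup>+x. cumul M h x epowr r \<partial>E) epowr (1 / r))
        \<le> ennreal (1 / test_const q p') * (C * Lp_norm M p h)"
      by (intro mult_left_mono) auto
    then show "(\<integral>\<^sup>+x. cumul M h x epowr r \<partial>E) epowr (1 / r)
       \<le> ennreal (1 / test_const q p') * C * (\<integral>\<^sup>+t. h t epowr p \<partial>M) epowr (1 / p)"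
      using t by (simp add: Lp_norm_def mult.assoc[symmetric] flip: ennreal_mult)
  qed
  then have "ennreal (test_const q p') * (ennreal (test_const r p) * X)
      \<le> ennreal (test_const q p') * (ennreal (1 / test_const q p') * C)"
    by (intro mult_left_mono) auto
  then show ?thesis
    using t test_const_pos[OF r0(2) rp]
    by (simp add: X_def mult.assoc[symmetric] flip: ennreal_mult)
qed

end

section \<open>Weights on a compact interval as diffuse measures\<close>

lemma nn_integral_lebesgue_on:
  "(\<integral>\<^sup>+t. f t \<partial>lebesgue_on {c..d}) = (\<integral>\<^sup>+t\<in>{c..d::real}. f t \<partial>lebesgue)"
  by (simp add: nn_integral_restrict_space)

lemma cumul_lebesgue_on:
  "x \<le> d \<Longrightarrow> cumul (lebesgue_on {c..d}) f x = (\<integral>\<^sup>+t\<in>{c..x}. f t \<partial>lebesgue)"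
  unfolding cumul_def nn_integral_lebesgue_on
  by (intro nn_integral_cong) (auto simp: indicator_def)

lemma tail_lebesgue_on:
  "c \<le> x \<Longrightarrow> tail (lebesgue_on {c..d}) f x = (\<integral>\<^sup>+t\<in>{x..d}. f t \<partial>lebesgue)"
  unfolding tail_def nn_integral_lebesgue_on
  by (intro nn_integral_cong) (auto simp: indicator_def)

lemma diffuse_lebesgue_on: "diffuse_measure (lebesgue_on {c..d})"
proof (intro diffuse_measure.intro finite_measureI diffuse_measure_axioms.intro)
  show "emeasure (lebesgue_on {c..d}) (space (lebesgue_on {c..d})) \<noteq> \<infinity>"
    by (cases "c \<le> d") (auto simp: emeasure_restrict_space)
  show "(\<lambda>x. x) \<in> borel_measurable (lebesgue_on {c..d})"
    by (intro measurable_restrict_space1 measurable_completion) simp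
  fix a :: real
  have "AE x in lebesgue. x \<noteq> a"
    using AE_lborel_singleton[of a] by (intro AE_completion)
  then show "AE x in lebesgue_on {c..d}. x \<noteq> a"
    by (subst AE_restrict_space_iff) (auto elim: eventually_mono)
qed

lemma inverse_conj_exp: "1 < p \<Longrightarrow> 1 / conj_exp p = 1 - 1 / p"
  by (simp add: conj_exp_def field_simps)

lemma divide_conj_exp: "1 < p \<Longrightarrow> r / conj_exp p = r * (1 - 1 / p)"
  using inverse_conj_exp[of p] by (metis mult.right_neutral times_divide_eq_right)

definition dual_measure :: "real \<Rightarrow> real \<Rightarrow> real \<Rightarrow> (real \<Rightarrow> ennreal) \<Rightarrow> real measure" where
  "dual_measure c d p v = density (lebesgue_on {c..d}) (\<lambda>x. v x epowr (1 - conj_exp p))"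

definition weight_measure :: "real \<Rightarrow> real \<Rightarrow> (real \<Rightarrow> ennreal) \<Rightarrow> real measure" where
  "weight_measure c d u = density (lebesgue_on {c..d}) u"

lemma AE_dual_measure_interior: 
  assumes [measurable]: "v \<in> borel_measurable (lebesgue_on {c..d})"
  shows "AE x in dual_measure c d p v. x \<in> {c<..<d}"
proof -
  interpret diffuse_measure "lebesgue_on {c..d}" by (rule diffuse_lebesgue_on)
  have "AE x in lebesgue_on {c..d}. x \<in> {c<..<d}"
    using null_points[of c] null_points[of d] AE_space
    by eventually_elim auto
  then show ?thesis
    unfolding dual_measure_def by (subst AE_density) (auto elim: eventually_mono)
qed

text \<open>
  The lower bound on \<open>v\<close> makes the measure \<open>\<sigma> dx\<close> finite, because the exponent \<open>1 - p'\<close> is negative.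
  Positivity and finiteness almost everywhere make \<open>\<sigma>\<close> invertible, so that every \<open>f\<close> is of the form
  \<open>\<sigma> h\<close> almost everywhere.
\<close>

locale interval_weight =
  fixes c d p :: real and v :: "real \<Rightarrow> ennreal"
  assumes p: "1 < p"
    and v_measurable [measurable]: "v \<in> borel_measurable (lebesgue_on {c..d})"
    and v_pos: "AE x in lebesgue_on {c..d}. 0 < v x \<and> v x < \<infinity>"
    and v_bdd: "\<exists>\<epsilon>>0. AE x in lebesgue_on {c..d}. ennreal \<epsilon> \<le> v x"
begin

abbreviation "M \<equiv> dual_measure c d p v"
abbreviation "\<sigma> x \<equiv> v x epowr (1 - conj_exp p)"

lemma dual_exponent: "1 - conj_exp p < 0" "(1 - conj_exp p) * p + 1 = 1 - conj_exp p"
  using p by (auto simp: conj_exp_def field_simps)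

lemma measurable_dual [simp]: "borel_measurable M = borel_measurable (lebesgue_on {c..d})"
  unfolding dual_measure_def by (rule measurable_cong_sets) simp_all

lemma diffuse_dual: "diffuse_measure M"
proof -
  interpret diffuse_measure "lebesgue_on {c..d}" by (rule diffuse_lebesgue_on)
  from v_bdd obtain \<epsilon> where e: "\<epsilon> > 0" "AE x in lebesgue_on {c..d}. ennreal \<epsilon> \<le> v x" by blast
  have "(\<integral>\<^sup>+x. \<sigma> x \<partial>lebesgue_on {c..d}) \<le> (\<integral>\<^sup>+x. ennreal (\<epsilon> powr (1 - conj_exp p)) \<partial>lebesgue_on {c..d})"
  proof (rule nn_integral_mono_AE)
    show "AE x in lebesgue_on {c..d}. \<sigma> x \<le> ennreal (\<epsilon> powr (1 - conj_exp p))"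
      using e(2)
    proof eventually_elim
      case (elim x)
      then show ?case
        using e(1) dual_exponent(1)
        by (cases "v x" rule: ennreal_zero_top_pos_cases) (auto simp: epowr_def intro!: ennreal_leI powr_mono2')
    qed
  qed
  also have "\<dots> < \<infinity>"
    by (simp add: ennreal_mult_less_top emeasure_eq_measure del: space_restrict_space)
  finally show ?thesis
    unfolding dual_measure_def by (intro density_diffuse) auto
qed

lemma cumul_dual:
  assumes [measurable]: "h \<in> borel_measurable (lebesgue_on {c..d})" "f \<in> borel_measurable (lebesgue_on {c..d})"
    and "AE x in lebesgue_on {c..d}. f x = \<sigma> x * h x" and "x \<le> d"
  shows "cumul M h x = (\<integral>\<^sup>+t\<in>{c..x}. f t \<partial>lebesgue)"
proof -
  interpret diffuse_measure "lebesgue_on {c..d}" by (rule diffuse_lebesgue_on)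
  have "cumul M h x = cumul (lebesgue_on {c..d}) (\<lambda>t. \<sigma> t * h t) x"
    unfolding dual_measure_def by (rule cumul_density) measurable
  also have "\<dots> = cumul (lebesgue_on {c..d}) f x"
    using assms(3) by (intro cumul_cong_AE) (auto elim: eventually_mono)
  finally show ?thesis using assms(4) by (simp add: cumul_lebesgue_on)
qed

lemma tail_dual:
  assumes [measurable]: "h \<in> borel_measurable (lebesgue_on {c..d})" and "c \<le> x"
  shows "tail M h x = (\<integral>\<^sup>+t\<in>{x..d}. \<sigma> t * h t \<partial>lebesgue)"
proof -
  interpret diffuse_measure "lebesgue_on {c..d}" by (rule diffuse_lebesgue_on)
  have "tail M h x = tail (lebesgue_on {c..d}) (\<lambda>t. \<sigma> t * h t) x"
    unfolding dual_measure_def by (rule tail_density) measurable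
  then show ?thesis using assms(2) by (simp add: tail_lebesgue_on)
qed

lemma integral_dual:
  assumes [measurable]: "h \<in> borel_measurable (lebesgue_on {c..d})"
  shows "(\<integral>\<^sup>+t. h t \<partial>M) = (\<integral>\<^sup>+t\<in>{c..d}. \<sigma> t * h t \<partial>lebesgue)"
  unfolding dual_measure_def nn_integral_lebesgue_on[symmetric]
  by (rule nn_integral_density) measurable

lemma Vdual_eq: "x \<le> d \<Longrightarrow> Vdual c p v x = distribution_fun M x"
  unfolding Vdual_def by (rule cumul_dual[symmetric]) auto

text \<open>
  The identity \<open>\<sigma>^p v = \<sigma>\<close> is the reason for the exponent \<open>1 - p'\<close>.
\<close>

lemma Lp_norm_dual:
  assumes [measurable]: "h \<in> borel_measurable (lebesgue_on {c..d})"
    and f: "AE x in lebesgue_on {c..d}. f x = \<sigma> x * h x"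
  shows "(\<integral>\<^sup>+x\<in>{c..d}. f x epowr p * v x \<partial>lebesgue) = (\<integral>\<^sup>+x. h x epowr p \<partial>M)"
proof -
  have "(\<integral>\<^sup>+x\<in>{c..d}. f x epowr p * v x \<partial>lebesgue) = (\<integral>\<^sup>+x. f x epowr p * v x \<partial>lebesgue_on {c..d})"
    by (simp add: nn_integral_lebesgue_on)
  also have "\<dots> = (\<integral>\<^sup>+x. \<sigma> x * h x epowr p \<partial>lebesgue_on {c..d})"
  proof (rule nn_integral_cong_AE)
    show "AE x in lebesgue_on {c..d}. f x epowr p * v x = \<sigma> x * h x epowr p"
      using f v_pos
    proof eventually_elim
      case (elim x)
      have "\<sigma> x epowr p * v x = v x epowr ((1 - conj_exp p) * p + 1)"
        using elim by (simp add: epowr_add_pos_fin)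
      then have "\<sigma> x epowr p * v x = \<sigma> x" by (simp only: dual_exponent(2))
      moreover have "f x epowr p * v x = \<sigma> x epowr p * v x * h x epowr p"
        unfolding elim(1) using p by (simp add: epowr_mult ac_simps)
      ultimately show ?case by simp
    qed
  qed
  also have "\<dots> = (\<integral>\<^sup>+x. h x epowr p \<partial>M)"
    unfolding dual_measure_def by (rule nn_integral_density[symmetric]) measurable
  finally show ?thesis .
qed

lemma quotient_exists:
  assumes [measurable]: "f \<in> borel_measurable (lebesgue_on {c..d})"
  shows "\<exists>h \<in> borel_measurable (lebesgue_on {c..d}). AE x in lebesgue_on {c..d}. f x = \<sigma> x * h x"
proof (intro bexI)
  show "AE x in lebesgue_on {c..d}. f x = \<sigma> x * (v x epowr (- (1 - conj_exp p)) * f x)"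
    using v_pos
  proof eventually_elim
    case (elim x)
    then show ?case using epowr_cancel[of "v x" "1 - conj_exp p"] by (simp add: mult.assoc[symmetric])
  qed
qed measurable

end

section \<open>The two-sided estimate in all parameter regions\<close>

text \<open>
  The summand \<open>1\<close> serves the case \<open>p \<le> q\<close>, where \<open>r_exp q p\<close> has no meaning, and the power serves the
  case \<open>q < p\<close>; the sum dominates the constant of either case.
\<close>

definition term_const :: "real \<Rightarrow> real \<Rightarrow> real \<Rightarrow> real" where
  "term_const p p' q = hardy_const p * (1 + (r_exp q p * hardy_const p') powr (q / r_exp q p))"

definition lower_const :: "real \<Rightarrow> real \<Rightarrow> real \<Rightarrow> real" where
  "lower_const p1 p2 q =
     (if p2 \<le> q then 1 else if p1 \<le> r_exp q p2 then test_const q p2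
      else test_const q p2 * test_const (r_exp q p2) p1)"

text \<open>
  The quantity attached to the term in which the second function carries the factor \<open>G^(q-1) g\<close>. The
  condition \<open>p1 \<le> r_exp q p2\<close> is \<open>1/q \<le> 1/p1 + 1/p2\<close> in disguise. With this definition the five cases
  of the theorem are one statement: the Hardy constant is comparable to the sum of this
  quantity and its mirror image under the exchange of the two functions.
\<close>

definition one_sided_quantity ::
  "real \<Rightarrow> real \<Rightarrow> real \<Rightarrow> real \<Rightarrow> real \<Rightarrow>
   (real \<Rightarrow> ennreal) \<Rightarrow> (real \<Rightarrow> ennreal) \<Rightarrow> (real \<Rightarrow> ennreal) \<Rightarrow> ennreal" where
  "one_sided_quantity p1 p2 q c d u v1 v2 =
     (if p2 \<le> q then hardy_A1 p1 p2 q c d u v1 v2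
      else if p1 \<le> r_exp q p2 then hardy_A2 p1 p2 q c d u v1 v2
      else hardy_A6 p1 p2 q c d u v1 v2)"

lemma hardy_A1_swap: "hardy_A1 p1 p2 q c d u v1 v2 = hardy_A1 p2 p1 q c d u v2 v1"
  by (simp add: hardy_A1_def ac_simps)

lemma hardy_A3_swap: "hardy_A3 p1 p2 q c d u v1 v2 = hardy_A2 p2 p1 q c d u v2 v1"
  by (simp add: hardy_A3_def hardy_A2_def)

lemma hardy_A7_swap: "hardy_A7 p1 p2 q c d u v1 v2 = hardy_A6 p2 p1 q c d u v2 v1"
proof -
  have "kappa_exp p1 p2 q = kappa_exp p2 p1 q" by (simp add: kappa_exp_def algebra_simps)
  then show ?thesis by (simp add: hardy_A7_def hardy_A6_def)
qed

lemma hardy_const_pos: "1 < p \<Longrightarrow> 0 < hardy_const p"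
  by (simp add: hardy_const_def)

lemma term_const_ge:
  assumes "1 < p"
  shows "hardy_const p \<le> term_const p p' q"
    and "hardy_const p * (r_exp q p * hardy_const p') powr (q / r_exp q p) \<le> term_const p p' q"
  using hardy_const_pos[OF assms] by (simp_all add: term_const_def distrib_left)

lemma term_const_pos: "1 < p \<Longrightarrow> 0 < term_const p p' q"
  using term_const_ge(1)[of p p' q] hardy_const_pos[of p] by linarith

lemma lower_const_pos:
  assumes "1 < q"
  shows "0 < lower_const p1 p2 q"
  using test_const_pos[of q p2] test_const_pos[of "r_exp q p2" p1] r_exp_gt[of q p2] assms
  by (auto simp: lower_const_def not_le)

locale bilinear_weights = W1: interval_weight c d p1 v1 + W2: interval_weight c d p2 v2
  for c d p1 p2 v1 v2 +
  fixes q :: real and u :: "real \<Rightarrow> ennreal"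
  assumes q: "1 < q" 
    and u_measurable [measurable]: "u \<in> borel_measurable (lebesgue_on {c..d})"
    and u_integrable: "(\<integral>\<^sup>+x\<in>{c..d}. u x \<partial>lebesgue) < \<infinity>"
begin

abbreviation "M1 \<equiv> dual_measure c d p1 v1"
abbreviation "M2 \<equiv> dual_measure c d p2 v2"
abbreviation "N \<equiv> weight_measure c d u"

lemma diffuse_weight: "diffuse_measure N"
  unfolding weight_measure_def using u_integrable
  by (intro diffuse_measure.density_diffuse diffuse_lebesgue_on) (auto simp: nn_integral_lebesgue_on)

sublocale L: diffuse_measure "lebesgue_on {c..d}" by (rule diffuse_lebesgue_on)
sublocale M1: diffuse_measure M1 by (rule W1.diffuse_dual)
sublocale M2: diffuse_measure M2 by (rule W2.diffuse_dual)
sublocale N: diffuse_measure N by (rule diffuse_weight)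

lemma Utail_eq: "c \<le> x \<Longrightarrow> Utail d u x = tail N (\<lambda>_. 1) x"
  unfolding Utail_def weight_measure_def
  by (subst tail_density) (auto simp: tail_lebesgue_on)

lemma inner_weight_eq:
  "t \<in> {c..d} \<Longrightarrow> Utail d u t epowr (r / q) * Vdual c p2 v2 t epowr (r / conj_exp q) = inner_weight N M2 q r t"
  by (simp add: inner_weight_def Utail_eq W2.Vdual_eq divide_conj_exp q)

lemma inner_weight_lebesgue [measurable]: "inner_weight N M2 q r \<in> borel_measurable (lebesgue_on {c..d})"
  by (rule M2.inner_weight_measurable[OF diffuse_weight]) measurable

lemma inner_integral_eq:
  assumes "c \<le> x"
  shows "(\<integral>\<^sup>+t\<in>{x..d}. Utail d u t epowr (r / q) * Vdual c p2 v2 t epowr (r / conj_exp q)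
                      * v2 t epowr (1 - conj_exp p2) \<partial>lebesgue) = tail M2 (inner_weight N M2 q r) x"
  unfolding W2.tail_dual[OF inner_weight_lebesgue assms] using assms
  by (intro nn_integral_cong) (auto simp: indicator_def mult.commute inner_weight_eq)

lemma hardy_A1_eq:
  "hardy_A1 p1 p2 q c d u v1 v2 =
    (SUP x\<in>{c<..<d}. tail N (\<lambda>_. 1) x epowr (1 / q) * distribution_fun M1 x epowr (1 - 1 / p1)
        * distribution_fun M2 x epowr (1 - 1 / p2))"
  unfolding hardy_A1_def
  by (intro SUP_cong) (auto simp: Utail_eq W1.Vdual_eq W2.Vdual_eq inverse_conj_exp W1.p W2.p)

lemma hardy_A2_eq:
  "hardy_A2 p1 p2 q c d u v1 v2 =
    (SUP x\<in>{c<..<d}. distribution_fun M1 x epowr (1 - 1 / p1)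
        * tail M2 (inner_weight N M2 q (r_exp q p2)) x epowr (1 / r_exp q p2))"
  unfolding hardy_A2_def Let_def
  by (intro SUP_cong) (auto simp: inner_integral_eq W1.Vdual_eq inverse_conj_exp W1.p)

lemma hardy_A6_eq:
  assumes "q < p2"
  defines "r \<equiv> r_exp q p2"
  defines "\<kappa> \<equiv> r_exp r p1"
  shows "hardy_A6 p1 p2 q c d u v1 v2 =
    (\<integral>\<^sup>+t. tail M2 (inner_weight N M2 q r) t epowr (\<kappa> / r) * distribution_fun M1 t epowr (\<kappa> * (1 - 1 / r)) \<partial>M1)
      epowr (1 / \<kappa>)"
proof -
  have "1 < r" using r_exp_gt[of q p2] assms q by simp
  have \<kappa>: "kappa_exp p1 p2 q = \<kappa>"
    by (simp add: kappa_exp_def \<kappa>_def r_def r_exp_def algebra_simps)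
  have [measurable]: "inner_weight N M2 q r \<in> borel_measurable M2" by simp
  have "(\<integral>\<^sup>+t. tail M2 (inner_weight N M2 q r) t epowr (\<kappa> / r) * distribution_fun M1 t epowr (\<kappa> * (1 - 1 / r)) \<partial>M1)
      = (\<integral>\<^sup>+t\<in>{c..d}. W1.\<sigma> t * (tail M2 (inner_weight N M2 q r) t epowr (\<kappa> / r)
           * distribution_fun M1 t epowr (\<kappa> * (1 - 1 / r))) \<partial>lebesgue)"
    by (rule W1.integral_dual) measurable
  also have "\<dots> = (\<integral>\<^sup>+t\<in>{c..d}. tail M2 (inner_weight N M2 q r) t epowr (\<kappa> / r)
         * Vdual c p1 v1 t epowr (\<kappa> / conj_exp r) * W1.\<sigma> t \<partial>lebesgue)"
    unfolding divide_conj_exp[OF \<open>1 < r\<close>]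
    by (intro nn_integral_cong) (auto simp: indicator_def W1.Vdual_eq mult.commute)
  also have "\<dots> = (\<integral>\<^sup>+x\<in>{c..d}. (\<integral>\<^sup>+t\<in>{x..d}. Utail d u t epowr (r / q) * Vdual c p2 v2 t epowr (r / conj_exp q)
                      * v2 t epowr (1 - conj_exp p2) \<partial>lebesgue) epowr (\<kappa> / r)
         * Vdual c p1 v1 x epowr (\<kappa> / conj_exp r) * W1.\<sigma> x \<partial>lebesgue)"
  proof (intro nn_integral_cong, goal_cases)
    case (1 x)
    then show ?case by (cases "x \<in> {c..d}") (simp_all add: inner_integral_eq)
  qed
  finally show ?thesis
    unfolding hardy_A6_def Let_def r_def[symmetric] \<kappa> by simp
qed

text \<open>
  The substitutions \<open>f = \<sigma>\<^sub>1 h\<close> and \<open>g = \<sigma>\<^sub>2 k\<close> put the admissible pairs for the two inequalities in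
  correspondence, up to null sets, without changing any of the three integrals.
\<close>

lemma bilinear_hardy_const_eq:
  "bilinear_hardy_const p1 p2 q c d u v1 v2 = Inf {C. C < \<infinity> \<and> bilinear_Hardy M1 M2 N p1 p2 q C}"
proof -
  let ?L = "borel_measurable (lebesgue_on {c..d}) :: (real \<Rightarrow> ennreal) set"
  define P where "P C f g \<longleftrightarrow> ((\<integral>\<^sup>+x\<in>{c..d}. f x epowr p1 * v1 x \<partial>lebesgue) < \<infinity> \<longrightarrow>
          (\<integral>\<^sup>+x\<in>{c..d}. g x epowr p2 * v2 x \<partial>lebesgue) < \<infinity> \<longrightarrow>
          (\<integral>\<^sup>+x\<in>{c..d}. ((\<integral>\<^sup>+t\<in>{c..x}. f t \<partial>lebesgue) * (\<integral>\<^sup>+t\<in>{c..x}. g t \<partial>lebesgue)) epowr q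
                        * u x \<partial>lebesgue) epowr (1 / q)
          \<le> C * (\<integral>\<^sup>+x\<in>{c..d}. f x epowr p1 * v1 x \<partial>lebesgue) epowr (1 / p1)
              * (\<integral>\<^sup>+x\<in>{c..d}. g x epowr p2 * v2 x \<partial>lebesgue) epowr (1 / p2))" for C f g
  define Q where "Q C h k \<longleftrightarrow> (Lp_norm M1 p1 h < \<infinity> \<longrightarrow> Lp_norm M2 p2 k < \<infinity> \<longrightarrow>
        (\<integral>\<^sup>+x. (cumul M1 h x * cumul M2 k x) epowr q \<partial>N) epowr (1 / q)
          \<le> C * Lp_norm M1 p1 h * Lp_norm M2 p2 k)" for C h k
  have PQ: "P C f g \<longleftrightarrow> Q C h k"
    if [measurable]: "f \<in> ?L" "g \<in> ?L" "h \<in> ?L" "k \<in> ?L"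
      and ae: "AE x in lebesgue_on {c..d}. f x = W1.\<sigma> x * h x" "AE x in lebesgue_on {c..d}. g x = W2.\<sigma> x * k x"
    for C f g h k
  proof -
    have [measurable]: "h \<in> borel_measurable M1" "k \<in> borel_measurable M2" by simp_all
    have "(\<integral>\<^sup>+x. (cumul M1 h x * cumul M2 k x) epowr q \<partial>N)
        = (\<integral>\<^sup>+x. u x * (cumul M1 h x * cumul M2 k x) epowr q \<partial>lebesgue_on {c..d})"
      unfolding weight_measure_def by (rule nn_integral_density) measurable
    also have "\<dots> = (\<integral>\<^sup>+x\<in>{c..d}. ((\<integral>\<^sup>+t\<in>{c..x}. f t \<partial>lebesgue) * (\<integral>\<^sup>+t\<in>{c..x}. g t \<partial>lebesgue)) epowr q
                        * u x \<partial>lebesgue)"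
      unfolding nn_integral_lebesgue_on
      by (intro nn_integral_cong)
         (auto simp: indicator_def W1.cumul_dual[OF that(3,1) ae(1)] W2.cumul_dual[OF that(4,2) ae(2)] mult.commute)
    finally show ?thesis
      using W1.Lp_norm_dual[OF that(3) ae(1)] W2.Lp_norm_dual[OF that(4) ae(2)] W1.p W2.p
      by (simp add: P_def Q_def Lp_norm_finite_iff) (simp add: Lp_norm_def)
  qed
  have "(\<forall>f\<in>?L. \<forall>g\<in>?L. P C f g) \<longleftrightarrow> (\<forall>h\<in>?L. \<forall>k\<in>?L. Q C h k)" for C
  proof safe
    fix h k assume P: "\<forall>f\<in>?L. \<forall>g\<in>?L. P C f g" and [measurable]: "h \<in> ?L" "k \<in> ?L"
    have "P C (\<lambda>x. W1.\<sigma> x * h x) (\<lambda>x. W2.\<sigma> x * k x)" using P by auto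
    then show "Q C h k" by (subst (asm) PQ[of _ _ h k]) auto
  next
    fix f g assume Q: "\<forall>h\<in>?L. \<forall>k\<in>?L. Q C h k" and f: "f \<in> ?L" and g: "g \<in> ?L"
    from W1.quotient_exists[OF f] W2.quotient_exists[OF g] Q show "P C f g"
      using PQ[OF f g] by blast
  qed
  then show ?thesis
    unfolding bilinear_hardy_const_def bilinear_Hardy_def P_def Q_def by simp
qed

text \<open>
  In the case \<open>q < p2\<close> the term reduces to a linear Hardy inequality for \<open>f\<close> from \<open>L^p1\<close> to \<open>L^r\<close>
  with \<open>r = r_exp q p2\<close>, and the case distinction between \<open>A\<^sub>2\<close> and \<open>A\<^sub>6\<close> is that between \<open>p1 \<le> r\<close>
  and \<open>r < p1\<close> there.
\<close>

lemma term_bounded: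
  "Hardy_term_bounded M2 M1 N p2 p1 q (term_const p2 p1 q) (one_sided_quantity p1 p2 q c d u v1 v2)"
proof (cases "p2 \<le> q")
  case True
  have "Hardy_term_bounded M2 M1 N p2 p1 q (hardy_const p2) (hardy_A1 p1 p2 q c d u v1 v2)"
    unfolding Hardy_term_bounded_def
  proof (intro ballI impI M2.Hardy_term_le W1.diffuse_dual diffuse_weight W2.p True W1.p)
    show "AE t in M2. tail N (\<lambda>_. 1) t epowr (1 / q) * distribution_fun M2 t epowr (1 - 1 / p2)
              * distribution_fun M1 t epowr (1 - 1 / p1) \<le> hardy_A1 p1 p2 q c d u v1 v2"
      using AE_dual_measure_interior[OF W2.v_measurable]
    proof eventually_elim
      case (elim t)
      then show ?case
        unfolding hardy_A1_eq by (intro SUP_upper2[of t]) (auto simp: ac_simps)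
    qed
  qed
  then show ?thesis
    by (rule Hardy_term_bounded_mono) (use True term_const_ge(1)[OF W2.p, of p1 q] q in \<open>simp_all add: one_sided_quantity_def\<close>)
next
  case False
  then have qp: "q < p2" by simp
  define r where "r = r_exp q p2"
  define w where "w = inner_weight N M2 q r"
  have [simp]: "w \<in> borel_measurable (lebesgue_on {c..d})" unfolding w_def by measurable
  have r: "q < r" "1 < r" using r_exp_gt[of q p2] q qp by (auto simp: r_def)
  have "Hardy_term_bounded M2 M1 N p2 p1 q (hardy_const p2 * (r * hardy_const p1) powr (q / r))
     (one_sided_quantity p1 p2 q c d u v1 v2)"
    unfolding Hardy_term_bounded_def r_def
  proof (intro ballI impI M2.Hardy_term_gt W1.diffuse_dual diffuse_weight q qp, fold r_def, fold w_def)
    show "0 \<le> r * hardy_const p1" using r hardy_const_pos[OF W1.p] by simp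
    fix g f assume "g \<in> borel_measurable M2" and f: "f \<in> borel_measurable M1"
      and fin: "Lp_norm M2 p2 g < \<infinity>" "Lp_norm M1 p1 f < \<infinity>"
    show "(\<integral>\<^sup>+t. w t * cumul M1 f t epowr r \<partial>M2)
       \<le> ennreal (r * hardy_const p1) * (Lp_norm M1 p1 f * one_sided_quantity p1 p2 q c d u v1 v2) epowr r"
    proof (cases "p1 \<le> r")
      case True
      have "AE t in M1. distribution_fun M1 t epowr (1 - 1 / p1) * tail M2 w t epowr (1 / r)
         \<le> hardy_A2 p1 p2 q c d u v1 v2"
        using AE_dual_measure_interior[OF W1.v_measurable]
      proof eventually_elim
        case (elim t)
        then show ?case
          unfolding hardy_A2_eq w_def r_def by (intro SUP_upper2[of t]) auto
      qed
      then show ?thesis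
        using True qp by (simp add: one_sided_quantity_def flip: r_def)
          (intro M1.Hardy_sufficiency_le W2.diffuse_dual f W1.p fin, auto)
    next
      case False
      then show ?thesis
        using M1.Hardy_sufficiency_gt[OF W2.diffuse_dual f, of w r p1] r qp fin
        by (simp add: one_sided_quantity_def hardy_A6_eq w_def flip: r_def)
    qed
  qed
  then show ?thesis
    unfolding r_def by (rule Hardy_term_bounded_mono) (use term_const_ge(2)[OF W2.p, of q p1] q in auto)
qed

lemma one_sided_lower:
  assumes C: "bilinear_Hardy M1 M2 N p1 p2 q C"
  shows "ennreal (lower_const p1 p2 q) * one_sided_quantity p1 p2 q c d u v1 v2 \<le> C"
proof -
  define r where "r = r_exp q p2"
  consider "p2 \<le> q" | "q < p2" "p1 \<le> r" | "q < p2" "r < p1" by linarith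
  then show ?thesis
  proof cases
    case 1
    then show ?thesis
      using M1.bilinear_Hardy_ge_A1[OF W2.diffuse_dual diffuse_weight W1.p W2.p q C]
      by (simp add: one_sided_quantity_def lower_const_def hardy_A1_eq SUP_le_iff)
  next
    case 2
    then show ?thesis
      using M1.bilinear_Hardy_ge_A2[OF W2.diffuse_dual diffuse_weight W1.p q 2(1) C]
      by (simp add: one_sided_quantity_def lower_const_def hardy_A2_eq SUP_mult_left_ennreal SUP_le_iff flip: r_def)
  next
    case 3
    then show ?thesis
      using M1.bilinear_Hardy_ge_A6[OF W2.diffuse_dual diffuse_weight W1.p q 3(1) _ C]
      by (simp add: one_sided_quantity_def lower_const_def hardy_A6_eq flip: r_def)
  qed
qed

end

text \<open>
  The exchange of the two functions turns each one-sided result into its mirror image, which is why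
  the bounds for one of the two terms suffice.
\<close>

lemma comparable_one_sided:
  assumes "bilinear_weights c d p1 p2 v1 v2 q u"
  shows "comparable_with (min (lower_const p1 p2 q) (lower_const p2 p1 q) / 2)
     ((q * (term_const p1 p2 q + term_const p2 p1 q)) powr (1 / q))
     (bilinear_hardy_const p1 p2 q c d u v1 v2)
     (one_sided_quantity p1 p2 q c d u v1 v2 + one_sided_quantity p2 p1 q c d u v2 v1)"
proof -
  interpret bilinear_weights c d p1 p2 v1 v2 q u by fact
  interpret S: bilinear_weights c d p2 p1 v2 v1 q u by unfold_locales (fact q u_measurable u_integrable)+
  define B where "B = one_sided_quantity p1 p2 q c d u v1 v2"
  define B' where "B' = one_sided_quantity p2 p1 q c d u v2 v1"
  define k where "k = min (lower_const p1 p2 q) (lower_const p2 p1 q)"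
  define K where "K = (q * (term_const p1 p2 q + term_const p2 p1 q)) powr (1 / q)"
  have k: "0 < k" "k \<le> lower_const p1 p2 q" "k \<le> lower_const p2 p1 q"
    using lower_const_pos[OF q] by (auto simp: k_def)
  have lower: "ennreal (k / 2) * (B + B') \<le> C" if C: "bilinear_Hardy M1 M2 N p1 p2 q C" for C
  proof -
    have "ennreal k * B \<le> C"
      using one_sided_lower[OF C] k unfolding B_def
      by (meson ennreal_leI mult_right_mono order_trans zero_le)
    moreover have "ennreal k * B' \<le> C"
      using S.one_sided_lower[OF bilinear_Hardy_swap[OF C]] k unfolding B'_def
      by (meson ennreal_leI mult_right_mono order_trans zero_le)
    ultimately have "ennreal (1 / 2) * (ennreal k * B + ennreal k * B') \<le> ennreal (1 / 2) * (C + C)"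
      by (intro mult_left_mono add_mono) auto
    also have "ennreal (1 / 2) * (C + C) = C"
    proof -
      have "ennreal (1 / 2) + ennreal (1 / 2) = 1"
        by (subst ennreal_plus[symmetric]) auto
      then show ?thesis by (metis distrib_left distrib_right mult_1)
    qed
    finally have "ennreal (1 / 2) * ennreal k * (B + B') \<le> C"
      by (simp only: distrib_left mult.assoc)
    also have "ennreal (1 / 2) * ennreal k = ennreal (k / 2)"
      using k by (subst ennreal_mult[symmetric]) auto
    finally show ?thesis .
  qed
  have tc: "0 \<le> term_const p1 p2 q" "0 \<le> term_const p2 p1 q"
    using term_const_pos[OF W1.p, of p2 q] term_const_pos[OF W2.p, of p1 q] by linarith+
  have upper: "bilinear_Hardy M1 M2 N p1 p2 q (ennreal K * (B + B'))"
    unfolding K_def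
    using Hardy_term_bounded_mono[OF S.term_bounded order_refl, of "B + B'"]
      Hardy_term_bounded_mono[OF term_bounded order_refl, of "B + B'"] q
    by (intro M1.bilinear_Hardy_of_terms W2.diffuse_dual diffuse_weight W1.p W2.p q tc) (auto simp: B_def B'_def)
  show ?thesis
    unfolding comparable_with_def bilinear_hardy_const_eq k_def[symmetric] K_def[symmetric]
      B_def[symmetric] B'_def[symmetric]
  proof
    show "ennreal (k / 2) * (B + B') \<le> Inf {C. C < \<infinity> \<and> bilinear_Hardy M1 M2 N p1 p2 q C}"
      using lower by (intro Inf_greatest) auto
    show "Inf {C. C < \<infinity> \<and> bilinear_Hardy M1 M2 N p1 p2 q C} \<le> ennreal K * (B + B')"
      using upper by (cases "ennreal K * (B + B') = top") (auto intro!: Inf_lower simp: less_top)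
  qed
qed

lemma comparable_with_mono:
  assumes "comparable_with k K C A" "k' \<le> k" "K \<le> K'"
  shows "comparable_with k' K' C A"
proof -
  have "ennreal k' * A \<le> ennreal k * A" "ennreal K * A \<le> ennreal K' * A"
    using assms by (auto intro!: mult_right_mono ennreal_leI)
  then show ?thesis
    using assms(1) unfolding comparable_with_def by (blast intro: order_trans)
qed

lemma comparable_with_double:
  assumes "comparable_with k K C (A + A)" "0 \<le> k" "0 \<le> K"
  shows "comparable_with k (2 * K) C A"
proof -
  have "ennreal k * A \<le> ennreal k * (A + A)"
    by (intro mult_left_mono add_increasing) auto
  moreover have "ennreal (2 * K) = ennreal K + ennreal K"
    using assms by (subst ennreal_plus[symmetric]) auto
  then have "ennreal K * (A + A) = ennreal (2 * K) * A"
    by (simp only: distrib_left distrib_right)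
  ultimately show ?thesis
    using assms by (auto simp: comparable_with_def)
qed

theorem theorem8p3:
  fixes p1 p2 q :: real
  assumes "1 < p1" and "1 < p2" and "1 < q"
  shows "\<exists>k K :: real. 0 < k \<and> k \<le> K \<and>
    (\<forall>(c::real) (d::real) (u :: real \<Rightarrow> ennreal) (v1 :: real \<Rightarrow> ennreal) (v2 :: real \<Rightarrow> ennreal).
       c < d \<longrightarrow>
       u \<in> borel_measurable (lebesgue_on {c..d}) \<longrightarrow>
       v1 \<in> borel_measurable (lebesgue_on {c..d}) \<longrightarrow>
       v2 \<in> borel_measurable (lebesgue_on {c..d}) \<longrightarrow>
       (AE x in lebesgue_on {c..d}. 0 < u x \<and> u x < \<infinity>) \<longrightarrow>
       (AE x in lebesgue_on {c..d}. 0 < v1 x \<and> v1 x < \<infinity>) \<longrightarrow>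
       (AE x in lebesgue_on {c..d}. 0 < v2 x \<and> v2 x < \<infinity>) \<longrightarrow>
       (\<integral>\<^sup>+x\<in>{c..d}. u x \<partial>lebesgue) < \<infinity> \<longrightarrow>
       (\<exists>\<epsilon>>0::real. AE x in lebesgue_on {c..d}. ennreal \<epsilon> \<le> v1 x) \<longrightarrow>
       (\<exists>\<epsilon>>0::real. AE x in lebesgue_on {c..d}. ennreal \<epsilon> \<le> v2 x) \<longrightarrow>
       (p1 \<le> q \<and> p2 \<le> q \<longrightarrow>
          comparable_with k K (bilinear_hardy_const p1 p2 q c d u v1 v2)
            (hardy_A1 p1 p2 q c d u v1 v2)) \<and>
       (p1 \<le> q \<and> q < p2 \<longrightarrow>
          comparable_with k K (bilinear_hardy_const p1 p2 q c d u v1 v2)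
            (hardy_A1 p1 p2 q c d u v1 v2 + hardy_A2 p1 p2 q c d u v1 v2)) \<and>
       (p2 \<le> q \<and> q < p1 \<longrightarrow>
          comparable_with k K (bilinear_hardy_const p1 p2 q c d u v1 v2)
            (hardy_A1 p1 p2 q c d u v1 v2 + hardy_A3 p1 p2 q c d u v1 v2)) \<and>
       (q < min p1 p2 \<and> 1 / q \<le> 1 / p1 + 1 / p2 \<longrightarrow>
          comparable_with k K (bilinear_hardy_const p1 p2 q c d u v1 v2)
            (hardy_A4 p1 p2 q c d u v1 v2 + hardy_A5 p1 p2 q c d u v1 v2)) \<and>
       (q < min p1 p2 \<and> 1 / q > 1 / p1 + 1 / p2 \<longrightarrow>
          comparable_with k K (bilinear_hardy_const p1 p2 q c d u v1 v2)
            (hardy_A6 p1 p2 q c d u v1 v2 + hardy_A7 p1 p2 q c d u v1 v2)))"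
proof -
  define k0 where "k0 = min (lower_const p1 p2 q) (lower_const p2 p1 q) / 2"
  define K0 where "K0 = (q * (term_const p1 p2 q + term_const p2 p1 q)) powr (1 / q)"
  have k0: "0 < k0" using lower_const_pos[OF assms(3)] by (simp add: k0_def)
  have K0: "0 < K0"
    using term_const_pos[OF assms(1), of p2 q] term_const_pos[OF assms(2), of p1 q] assms by (simp add: K0_def)
  have r_gt: "b < r_exp q a" if "b \<le> q" "q < a" for a b
    using r_exp_gt[of q a] that assms by simp
  have r_le_iff: "a \<le> r_exp q b \<longleftrightarrow> 1 / q \<le> 1 / p1 + 1 / p2" if "q < b" "(a = p1 \<and> b = p2) \<or> (a = p2 \<and> b = p1)" for a b
  proof -
    have "0 < r_exp q b" "0 < a" using r_exp_pos[of q b] that assms by auto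
    then have "a \<le> r_exp q b \<longleftrightarrow> 1 / r_exp q b \<le> 1 / a"
      by (simp add: field_simps)
    also have "1 / r_exp q b = 1 / q - 1 / b" by (simp add: r_exp_def)
    finally show ?thesis using that(2) by auto
  qed
  show ?thesis
  proof (rule exI[of _ "min k0 (2 * K0)"], rule exI[of _ "2 * K0"], intro conjI allI impI)
    show "0 < min k0 (2 * K0)" "min k0 (2 * K0) \<le> 2 * K0" using k0 K0 by auto
    fix c d :: real and u v1 v2 :: "real \<Rightarrow> ennreal"
    assume *: "c < d"
       "u \<in> borel_measurable (lebesgue_on {c..d})"
       "v1 \<in> borel_measurable (lebesgue_on {c..d})"
       "v2 \<in> borel_measurable (lebesgue_on {c..d})"
       "AE x in lebesgue_on {c..d}. 0 < u x \<and> u x < \<infinity>"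
       "AE x in lebesgue_on {c..d}. 0 < v1 x \<and> v1 x < \<infinity>"
       "AE x in lebesgue_on {c..d}. 0 < v2 x \<and> v2 x < \<infinity>"
       "(\<integral>\<^sup>+x\<in>{c..d}. u x \<partial>lebesgue) < \<infinity>"
       "\<exists>\<epsilon>>0::real. AE x in lebesgue_on {c..d}. ennreal \<epsilon> \<le> v1 x"
       "\<exists>\<epsilon>>0::real. AE x in lebesgue_on {c..d}. ennreal \<epsilon> \<le> v2 x"
    define C where "C = bilinear_hardy_const p1 p2 q c d u v1 v2"
    define B where "B = one_sided_quantity p1 p2 q c d u v1 v2"
    define B' where "B' = one_sided_quantity p2 p1 q c d u v2 v1"
    have "bilinear_weights c d p1 p2 v1 v2 q u"
      using assms * by unfold_locales auto
    from comparable_one_sided[OF this] have cmp: "comparable_with k0 K0 C (B + B')"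
      by (simp add: k0_def K0_def C_def B_def B'_def)
    then have main: "comparable_with (min k0 (2 * K0)) (2 * K0) C (B + B')"
      by (rule comparable_with_mono) (use K0 in auto)
    show "comparable_with (min k0 (2 * K0)) (2 * K0) (bilinear_hardy_const p1 p2 q c d u v1 v2)
            (hardy_A1 p1 p2 q c d u v1 v2)" if "p1 \<le> q \<and> p2 \<le> q"
    proof -
      \<comment> \<open>Both one-sided quantities equal \<open>A\<^sub>1\<close> here, hence the doubled upper constant.\<close>
      have "B = hardy_A1 p1 p2 q c d u v1 v2" "B' = hardy_A1 p1 p2 q c d u v1 v2"
        using that by (simp_all add: B_def B'_def one_sided_quantity_def hardy_A1_swap[of p2 p1])
      then have "comparable_with k0 (2 * K0) C (hardy_A1 p1 p2 q c d u v1 v2)"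
        using cmp k0 K0 by (intro comparable_with_double) auto
      then show ?thesis
        unfolding C_def by (rule comparable_with_mono) auto
    qed
    show "comparable_with (min k0 (2 * K0)) (2 * K0) (bilinear_hardy_const p1 p2 q c d u v1 v2)
            (hardy_A1 p1 p2 q c d u v1 v2 + hardy_A2 p1 p2 q c d u v1 v2)" if "p1 \<le> q \<and> q < p2"
    proof -
      have "B = hardy_A2 p1 p2 q c d u v1 v2" "B' = hardy_A1 p1 p2 q c d u v1 v2"
        using that r_gt[of p1 p2] by (simp_all add: B_def B'_def one_sided_quantity_def hardy_A1_swap[of p2 p1])
      then show ?thesis using main by (simp add: C_def add.commute)
    qed
    show "comparable_with (min k0 (2 * K0)) (2 * K0) (bilinear_hardy_const p1 p2 q c d u v1 v2)
            (hardy_A1 p1 p2 q c d u v1 v2 + hardy_A3 p1 p2 q c d u v1 v2)" if "p2 \<le> q \<and> q < p1"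
    proof -
      have "B = hardy_A1 p1 p2 q c d u v1 v2" "B' = hardy_A3 p1 p2 q c d u v1 v2"
        using that r_gt[of p2 p1] by (simp_all add: B_def B'_def one_sided_quantity_def hardy_A3_swap)
      then show ?thesis using main by (simp add: C_def)
    qed
    show "comparable_with (min k0 (2 * K0)) (2 * K0) (bilinear_hardy_const p1 p2 q c d u v1 v2)
            (hardy_A4 p1 p2 q c d u v1 v2 + hardy_A5 p1 p2 q c d u v1 v2)"
      if "q < min p1 p2 \<and> 1 / q \<le> 1 / p1 + 1 / p2"
    proof -
      have "B = hardy_A2 p1 p2 q c d u v1 v2" "B' = hardy_A3 p1 p2 q c d u v1 v2"
        using that r_le_iff[of p2 p1] r_le_iff[of p1 p2]
        by (simp_all add: B_def B'_def one_sided_quantity_def hardy_A3_swap)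
      then show ?thesis using main by (simp add: C_def)
    qed
    show "comparable_with (min k0 (2 * K0)) (2 * K0) (bilinear_hardy_const p1 p2 q c d u v1 v2)
            (hardy_A6 p1 p2 q c d u v1 v2 + hardy_A7 p1 p2 q c d u v1 v2)"
      if "q < min p1 p2 \<and> 1 / q > 1 / p1 + 1 / p2"
    proof -
      have "B = hardy_A6 p1 p2 q c d u v1 v2" "B' = hardy_A7 p1 p2 q c d u v1 v2"
        using that r_le_iff[of p2 p1] r_le_iff[of p1 p2]
        by (simp_all add: B_def B'_def one_sided_quantity_def hardy_A7_swap)
      then show ?thesis using main by (simp add: C_def)
    qed
  qed
qed

end
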